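(* We have $$\sup\left\{\lambda_1^{S^1}(g)\,\mathrm{Vol}(g)\right\}=\infty,$$ where the supremum is taken over all $S^1$-invariant Riemannian metrics $g$ on the torus $T^2$ such that $(T^2,g)$ can be isometrically embedded as a surface of revolution in Euclidean space $\mathbb{R}^3$.
   Context: A surface of revolution in $\mathbb{R}^3$ is a surface invariant under the group $S^1$ of rotations about a fixed axis; the $S^1$-action on $T^2$ is the one induced by this rotation action through the embedding. For an $S^1$-invariant metric $g$ on $T^2$, $\lambda_1^{S^1}(g)$ denotes the first nonzero eigenvalue of the Laplace-Beltrami operator $\Delta_g$ acting on $S^1$-invariant functions, and $\mathrm{Vol}(g)$ is the area of $(T^2,g)$. *)

theory Defs
  imports "HOL-Analysis.Analysis"
begin

primrec C_times :: "nat \<Rightarrow> ('a::euclidean_space \<Rightarrow> 'b::real_normed_vector) \<Rightarrow> bool" where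
  "C_times 0 f \<longleftrightarrow> continuous_on UNIV f"
| "C_times (Suc k) f \<longleftrightarrow>
     (\<forall>x. f differentiable (at x)) \<and>
     (\<forall>v. C_times k (\<lambda>x. frechet_derivative f (at x) v))"

definition smooth :: "('a::euclidean_space \<Rightarrow> 'b::real_normed_vector) \<Rightarrow> bool" where
  "smooth f \<longleftrightarrow> (\<forall>k. C_times k f)"


text \<open>The torus is \<open>\<real>\<^sup>2 / \<int>\<^sup>2\<close>. Its smooth structure is the one for which \<open>abs_torus2\<close> is a
  smooth covering map, so all differential notions below are expressed in the coordinates of
  the covering plane, in which the tangent bundle is trivial.\<close>

quotient_type torus2 = "real ^ 2" / "\<lambda>x y. \<forall>i. y $ i - x $ i \<in> \<int>"
proof (rule equivpI)
  show "reflp (\<lambda>x y :: real ^ 2. \<forall>i. y $ i - x $ i \<in> \<int>)"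
    by (simp add: reflp_def)
  show "symp (\<lambda>x y :: real ^ 2. \<forall>i. y $ i - x $ i \<in> \<int>)"
    unfolding symp_def by (metis Ints_minus minus_diff_eq)
  show "transp (\<lambda>x y :: real ^ 2. \<forall>i. y $ i - x $ i \<in> \<int>)"
  proof (rule transpI, rule allI)
    fix x y z :: "real ^ 2" and i
    assume "\<forall>i. y $ i - x $ i \<in> \<int>" "\<forall>i. z $ i - y $ i \<in> \<int>"
    then have "(y $ i - x $ i) + (z $ i - y $ i) \<in> \<int>" by (intro Ints_add) auto
    then show "z $ i - x $ i \<in> \<int>" by simp
  qed
qed

definition smooth_on_torus :: "(torus2 \<Rightarrow> 'b::real_normed_vector) \<Rightarrow> bool" where
  "smooth_on_torus u \<longleftrightarrow> smooth (\<lambda>x. u (abs_torus2 x))"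

definition riemannian_metric :: "(torus2 \<Rightarrow> real ^ 2 ^ 2) \<Rightarrow> bool" where
  "riemannian_metric g \<longleftrightarrow> smooth_on_torus g \<and>
     (\<forall>p. transpose (g p) = g p \<and> (\<forall>v. v \<noteq> 0 \<longrightarrow> v \<bullet> (g p *v v) > 0))"

definition Vol :: "(torus2 \<Rightarrow> real ^ 2 ^ 2) \<Rightarrow> real" where
  "Vol g = integral (cbox 0 1) (\<lambda>x. sqrt (det (g (abs_torus2 x))))"

definition partial_deriv :: "2 \<Rightarrow> (real ^ 2 \<Rightarrow> real) \<Rightarrow> real ^ 2 \<Rightarrow> real" where
  "partial_deriv i u x = frechet_derivative u (at x) (axis i 1)"

text \<open>The sign is that of \<open>- div grad\<close>, so that eigenvalues are nonnegative.\<close>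

definition laplace_beltrami ::
    "(real ^ 2 \<Rightarrow> real ^ 2 ^ 2) \<Rightarrow> (real ^ 2 \<Rightarrow> real) \<Rightarrow> real ^ 2 \<Rightarrow> real" where
  "laplace_beltrami h u x =
     - (1 / sqrt (det (h x))) *
       (\<Sum>i\<in>UNIV. partial_deriv i
          (\<lambda>y. sqrt (det (h y)) * (\<Sum>j\<in>UNIV. matrix_inv (h y) $ i $ j * partial_deriv j u y)) x)"


text \<open>A group action enters only through the set \<open>G\<close> of the transformations of the torus by
  which the group acts.\<close>

definition invariant_function :: "(torus2 \<Rightarrow> torus2) set \<Rightarrow> (torus2 \<Rightarrow> real) \<Rightarrow> bool" where
  "invariant_function G u \<longleftrightarrow> (\<forall>\<phi>\<in>G. \<forall>p. u (\<phi> p) = u p)"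

text \<open>\<open>\<Phi>\<close> is a lift of \<open>\<phi>\<close> to the covering plane; it represents the differential of \<open>\<phi>\<close>.\<close>

definition invariant_metric ::
    "(torus2 \<Rightarrow> torus2) set \<Rightarrow> (torus2 \<Rightarrow> real ^ 2 ^ 2) \<Rightarrow> bool" where
  "invariant_metric G g \<longleftrightarrow>
     (\<forall>\<phi>\<in>G. \<exists>\<Phi> :: real ^ 2 \<Rightarrow> real ^ 2. smooth \<Phi> \<and>
        (\<forall>x. \<phi> (abs_torus2 x) = abs_torus2 (\<Phi> x)) \<and>
        (\<forall>x v w. frechet_derivative \<Phi> (at x) v \<bullet>
                   (g (abs_torus2 (\<Phi> x)) *v frechet_derivative \<Phi> (at x) w)
                 = v \<bullet> (g (abs_torus2 x) *v w)))"

definition invariant_eigenvalue ::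
    "(torus2 \<Rightarrow> torus2) set \<Rightarrow> (torus2 \<Rightarrow> real ^ 2 ^ 2) \<Rightarrow> real \<Rightarrow> bool" where
  "invariant_eigenvalue G g \<mu> \<longleftrightarrow>
     (\<exists>u. smooth_on_torus u \<and> invariant_function G u \<and> (\<exists>p. u p \<noteq> 0) \<and>
        (\<forall>x. laplace_beltrami (\<lambda>y. g (abs_torus2 y)) (\<lambda>y. u (abs_torus2 y)) x
              = \<mu> * u (abs_torus2 x)))"

definition lambda1 :: "(torus2 \<Rightarrow> torus2) set \<Rightarrow> (torus2 \<Rightarrow> real ^ 2 ^ 2) \<Rightarrow> real" where
  "lambda1 G g = (LEAST \<mu>. \<mu> \<noteq> 0 \<and> invariant_eigenvalue G g \<mu>)"


text \<open>The axis is the line through \<open>c\<close> with direction \<open>n \<noteq> 0\<close>.\<close>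

definition rotations_about :: "real ^ 3 \<Rightarrow> real ^ 3 \<Rightarrow> (real ^ 3 \<Rightarrow> real ^ 3) set" where
  "rotations_about c n = {\<lambda>x. c + A *v (x - c) | A. rotation_matrix A \<and> A *v n = n}"

definition revolution_about :: "real ^ 3 \<Rightarrow> real ^ 3 \<Rightarrow> (real ^ 3) set \<Rightarrow> bool" where
  "revolution_about c n S \<longleftrightarrow> n \<noteq> 0 \<and> (\<forall>T\<in>rotations_about c n. T ` S = S)"

text \<open>The metric condition makes \<open>f\<close> an immersion, and an injective immersion of the compact torus
  is an embedding.\<close>

definition isometric_embedding :: "(torus2 \<Rightarrow> real ^ 2 ^ 2) \<Rightarrow> (torus2 \<Rightarrow> real ^ 3) \<Rightarrow> bool" where
  "isometric_embedding g f \<longleftrightarrow> smooth_on_torus f \<and> inj f \<and>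
     (\<forall>x v w. frechet_derivative (\<lambda>y. f (abs_torus2 y)) (at x) v \<bullet>
              frechet_derivative (\<lambda>y. f (abs_torus2 y)) (at x) w
              = v \<bullet> (g (abs_torus2 x) *v w))"

definition induced_action ::
    "real ^ 3 \<Rightarrow> real ^ 3 \<Rightarrow> (torus2 \<Rightarrow> real ^ 3) \<Rightarrow> (torus2 \<Rightarrow> torus2) set" where
  "induced_action c n f = {\<lambda>p. inv f (T (f p)) | T. T \<in> rotations_about c n}"

end

(* The embeddings are the standard tori of revolution whose generating circle has radius 1/(2 pi)
   and centre at distance A/(2 pi) from the axis, with A large. In the coordinates of the covering
   plane the metric is dx^2 + r(x)^2 dy^2 with r(x) = A + cos (2 pi x), so the area is about A, and
   the invariant eigenvalue problem is the 1-periodic Sturm-Liouville problem (r u')' = - mu r u.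

   Its least nonzero eigenvalue is 1/M, where M is the maximum of the Rayleigh quotient of the Green
   operator on functions of r-weighted mean zero. The maximum is attained: if f_n is a normalised
   maximising sequence, then ||K f_n - M f_n|| tends to 0 because ||K f||^2 <= M (K f, f), and K f_n
   subconverges uniformly by Arzela-Ascoli. If a <= r <= b then M <= b/a, hence
   lambda_1 >= (A - 1)/(A + 1), and lambda_1 Vol is unbounded as A grows. *)

theory Submission
  imports Defs "HOL-Complex_Analysis.Great_Picard"
begin

section \<open>The periodic Sturm-Liouville problem\<close>

text \<open>\<open>lambda1\<close> is defined by \<open>LEAST\<close>, so a lower bound for all
  eigenvalues says nothing about it until a smallest nonzero one is known to exist. This is why the
  maximum must be attained and why so much of the proof serves a compactness argument. The
  maximising sequence consists of continuous functions, which are not complete for the weighted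
  norm; hence no limit of f_n itself is taken, only of the images K f_n, which are uniformly
  Lipschitz. The product is unbounded because the generating circle keeps length 1 while the area
  grows. Functions varying along the long parallels would have small eigenvalues, but they are not
  invariant. As A grows, lambda_1 in fact tends to 4 pi^2; the cruder bound suffices because it
  stays away from 0.\<close>

lemma integral_01_deriv:
  fixes F f :: "real \<Rightarrow> real"
  assumes "\<And>x. x \<in> {0..1} \<Longrightarrow> (F has_real_derivative f x) (at x within {0..1})"
  shows "integral {0..1} f = F 1 - F 0"
  using assms
  by (intro integral_unique fundamental_theorem_of_calculus)
     (auto simp flip: has_real_derivative_iff_has_vector_derivative)

lemma integral_linear_combination3:
  fixes u v w :: "real \<Rightarrow> real"
  assumes "u integrable_on S" "v integrable_on S" "w integrable_on S"
  shows "integral S (\<lambda>x. u x - c * v x + d * w x)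
    = integral S u - c * integral S v + d * integral S w"
proof -
  note I = assms[THEN integrable_integral]
  have "((\<lambda>x. u x - c * v x + d * w x) has_integral
      (integral S u - c * integral S v + d * integral S w)) S"
    by (intro has_integral_add has_integral_diff has_integral_mult_right I)
  then show ?thesis by (rule integral_unique)
qed

text \<open>The weight is arbitrary because two are needed: \<open>r\<close> for \<open>ip\<close>
  and \<open>1 / r\<close> for \<open>energy\<close>. The proof uses that the weighted square norm
  of f - t g is a nonnegative quadratic polynomial in t.\<close>

lemma weighted_Cauchy_Schwarz:
  fixes p f g :: "real \<Rightarrow> real"
  assumes p: "continuous_on {0..1} p" "\<And>x. x \<in> {0..1} \<Longrightarrow> 0 \<le> p x"
    and f: "continuous_on {0..1} f" and g: "continuous_on {0..1} g"
  shows "(integral {0..1} (\<lambda>x. p x * f x * g x))\<^sup>2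
    \<le> integral {0..1} (\<lambda>x. p x * f x * f x) * integral {0..1} (\<lambda>x. p x * g x * g x)"
proof -
  define A B C where "A = integral {0..1} (\<lambda>x. p x * f x * f x)"
    and "B = integral {0..1} (\<lambda>x. p x * f x * g x)"
    and "C = integral {0..1} (\<lambda>x. p x * g x * g x)"
  have int: "(\<lambda>x. p x * u x * v x) integrable_on {0..1}"
    if "continuous_on {0..1} u" "continuous_on {0..1} v" for u v
    using that by (intro integrable_continuous_interval continuous_intros p)
  have *: "0 \<le> A - 2 * t * B + t\<^sup>2 * C" for t
  proof -
    have "integral {0..1} (\<lambda>x. p x * (f x - t * g x) * (f x - t * g x)) =
      integral {0..1} (\<lambda>x. p x * f x * f x - 2 * t * (p x * f x * g x) + t\<^sup>2 * (p x * g x * g x))"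
      by (intro arg_cong[where f="integral {0..1}"] ext) (simp add: algebra_simps power2_eq_square)
    also have "\<dots> = A - 2 * t * B + t\<^sup>2 * C"
      unfolding A_def B_def C_def
      by (rule integral_linear_combination3[OF int[OF f f] int[OF f g] int[OF g g]])
    finally have "A - 2 * t * B + t\<^sup>2 * C = integral {0..1} (\<lambda>x. p x * (f x - t * g x) * (f x - t * g x))"
      by simp
    also have "0 \<le> \<dots>"
      by (intro integral_nonneg int continuous_intros f g) (auto simp: mult.assoc p)
    finally show ?thesis .
  qed
  have "0 \<le> C"
    unfolding C_def using p g by (intro integral_nonneg int) (auto simp: mult.assoc)
  show ?thesis
  proof (cases "C = 0")
    case True
    have "B = 0"
    proof (rule ccontr)
      assume "B \<noteq> 0"
      \<comment> \<open>For C = 0 the polynomial is affine in t, and this t gives it the value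
        -1.\<close>
      then show False
        using *[of "(A + 1) / (2 * B)"] True by (simp add: field_simps)
    qed
    then show ?thesis using True by (simp flip: A_def B_def C_def)
  next
    case False
    then have "C > 0" using \<open>0 \<le> C\<close> by simp
    \<comment> \<open>t = B / C is the minimiser of the quadratic; the factor C clears the
      denominators.\<close>
    have "0 \<le> C * (A - 2 * (B / C) * B + (B / C)\<^sup>2 * C)"
      using *[of "B / C"] \<open>C > 0\<close> by (intro mult_nonneg_nonneg) auto
    also have "\<dots> = A * C - B\<^sup>2"
      using \<open>C > 0\<close> by (simp add: field_simps power2_eq_square)
    finally show ?thesis by (simp flip: A_def B_def C_def)
  qed
qed

lemma integral_pos:
  assumes "continuous_on {0..1} p" "\<And>x. x \<in> {0..1} \<Longrightarrow> 0 < p x"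
  shows "0 < integral {0..1} (p :: real \<Rightarrow> real)"
proof -
  have "integral {0..1} p \<noteq> 0"
  proof
    assume "integral {0..1} p = 0"
    then have "\<forall>x\<in>{0..1}. p x = 0"
      using assms by (subst (asm) integral_eq_0_iff) (auto intro: less_imp_le)
    then show False using assms(2)[of 0] by auto
  qed
  moreover have "0 \<le> integral {0..1} p"
    using assms by (intro integral_nonneg integrable_continuous_interval) (auto intro: less_imp_le)
  ultimately show ?thesis by simp
qed

section \<open>The Green operator of a weighted periodic problem\<close>

locale weight =
  fixes r :: "real \<Rightarrow> real" and a b :: real
  assumes r_cont: "continuous_on {0..1} r"
    and a_pos: "0 < a"
    and r_bounds: "\<And>x. x \<in> {0..1} \<Longrightarrow> a \<le> r x \<and> r x \<le> b"
begin

lemma r_pos: "x \<in> {0..1} \<Longrightarrow> 0 < r x"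
  using r_bounds[of x] a_pos by linarith

lemma r_nz [simp]: "x \<in> {0..1} \<Longrightarrow> r x \<noteq> 0"
  using r_pos by force

lemma b_pos: "0 < b"
  using r_bounds[of 0] a_pos by auto

lemma integral_r_pos: "0 < integral {0..1} r"
  by (intro integral_pos r_cont r_pos)

lemma integral_inverse_r_pos: "0 < integral {0..1} (\<lambda>x. 1 / r x)"
  by (intro integral_pos continuous_intros r_cont) (auto simp: r_pos)

definition ip :: "(real \<Rightarrow> real) \<Rightarrow> (real \<Rightarrow> real) \<Rightarrow> real" where
  "ip f g = integral {0..1} (\<lambda>x. r x * f x * g x)"

text \<open>The orthogonal complement of the constants among continuous functions. Membership says
  nothing about the endpoints: eigenfunctions get their periodicity from
  \<open>green_ends\<close>.\<close>

definition mean_zero :: "(real \<Rightarrow> real) set" where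
  "mean_zero = {f. continuous_on {0..1} f \<and> integral {0..1} (\<lambda>x. r x * f x) = 0}"

definition prim :: "(real \<Rightarrow> real) \<Rightarrow> real \<Rightarrow> real" where
  "prim f x = integral {0..x} (\<lambda>t. r t * f t)"

text \<open>The constant makes the integral of \<open>flux f / r\<close> vanish
  (\<open>flux_mean\<close>), so that the primitive \<open>pot f\<close> takes equal values at 0 and
  1.\<close>

definition flux :: "(real \<Rightarrow> real) \<Rightarrow> real \<Rightarrow> real" where
  "flux f x = integral {0..1} (\<lambda>t. prim f t / r t) / integral {0..1} (\<lambda>t. 1 / r t) - prim f x"

definition pot :: "(real \<Rightarrow> real) \<Rightarrow> real \<Rightarrow> real" where
  "pot f x = integral {0..x} (\<lambda>t. flux f t / r t)"

text \<open>On mean-zero functions, \<open>green\<close> inverts the operator \<open>u \<mapsto> - (r u')' / r\<close> with periodic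
  boundary conditions; \<open>flux f\<close> is \<open>r u'\<close> for the solution \<open>u\<close>.\<close>

definition green :: "(real \<Rightarrow> real) \<Rightarrow> real \<Rightarrow> real" where
  "green f x = pot f x - integral {0..1} (\<lambda>t. r t * pot f t) / integral {0..1} r"

text \<open>The Dirichlet form of the potentials: for u = \<open>green f\<close> and v =
  \<open>green g\<close> the integrand is r u' v'.\<close>

definition energy :: "(real \<Rightarrow> real) \<Rightarrow> (real \<Rightarrow> real) \<Rightarrow> real" where
  "energy f g = integral {0..1} (\<lambda>x. 1 / r x * flux f x * flux g x)"

lemma mean_zeroD:
  assumes "f \<in> mean_zero"
  shows "continuous_on {0..1} f" "integral {0..1} (\<lambda>x. r x * f x) = 0"
  using assms by (auto simp: mean_zero_def)

lemma prim_deriv: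
  assumes "continuous_on {0..1} f" "x \<in> {0..1}"
  shows "(prim f has_real_derivative r x * f x) (at x within {0..1})"
  unfolding prim_def
  by (rule integral_has_real_derivative) (use assms in \<open>auto intro!: continuous_intros r_cont\<close>)

lemma flux_deriv:
  assumes "continuous_on {0..1} f" "x \<in> {0..1}"
  shows "(flux f has_real_derivative - (r x * f x)) (at x within {0..1})"
  unfolding flux_def
  using prim_deriv[OF assms] by (auto intro!: derivative_eq_intros)

lemma prim_cont: "continuous_on {0..1} f \<Longrightarrow> continuous_on {0..1} (prim f)"
  by (rule DERIV_continuous_on[OF prim_deriv])

lemma flux_cont: "continuous_on {0..1} f \<Longrightarrow> continuous_on {0..1} (flux f)"
  by (rule DERIV_continuous_on[OF flux_deriv])

lemma flux_mean:
  assumes "continuous_on {0..1} f"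
  shows "integral {0..1} (\<lambda>x. flux f x / r x) = 0"
proof -
  define c where "c = integral {0..1} (\<lambda>t. prim f t / r t) / integral {0..1} (\<lambda>t. 1 / r t)"
  have "integral {0..1} (\<lambda>x. flux f x / r x)
      = integral {0..1} (\<lambda>x. c * (1 / r x) - prim f x / r x)"
    by (simp add: flux_def c_def diff_divide_distrib)
  also have "\<dots> = c * integral {0..1} (\<lambda>x. 1 / r x) - integral {0..1} (\<lambda>x. prim f x / r x)"
    by (subst integral_diff)
       (auto intro!: integrable_continuous_interval continuous_intros r_cont prim_cont assms
         simp del: times_divide_eq_right)
  also have "\<dots> = 0" using integral_inverse_r_pos by (simp add: c_def)
  finally show ?thesis .
qed

lemma flux_ends:
  assumes "f \<in> mean_zero"
  shows "flux f 1 = flux f 0"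
  using mean_zeroD[OF assms] by (simp add: flux_def prim_def)

text \<open>W and \<open>flux f\<close> differ by a constant c, and comparing the integrals against
  1 / r gives c = 0. This yields the linearity of \<open>flux\<close> and later recognises the flux
  of a given eigenfunction.\<close>

lemma flux_unique:
  assumes f: "continuous_on {0..1} f"
    and W: "\<And>x. x \<in> {0..1} \<Longrightarrow> (W has_real_derivative - (r x * f x)) (at x within {0..1})"
    and m: "integral {0..1} (\<lambda>x. W x / r x) = 0" and x: "x \<in> {0..1}"
  shows "W x = flux f x"
proof -
  have "\<exists>c. \<forall>x\<in>{0..1}. W x - flux f x = c"
    by (rule has_field_derivative_zero_constant)
       (auto intro!: derivative_eq_intros W flux_deriv f)
  then obtain c where c: "\<And>x. x \<in> {0..1} \<Longrightarrow> W x - flux f x = c" by auto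
  have "0 = integral {0..1} (\<lambda>x. W x / r x) - integral {0..1} (\<lambda>x. flux f x / r x)"
    using m flux_mean[OF f] by simp
  also have "\<dots> = integral {0..1} (\<lambda>x. W x / r x - flux f x / r x)"
    by (intro integral_diff[symmetric] integrable_continuous_interval continuous_intros r_cont
         flux_cont f DERIV_continuous_on[OF W]) auto
  also have "\<dots> = integral {0..1} (\<lambda>x. c * (1 / r x))"
    by (intro integral_cong) (simp flip: c diff_divide_distrib)
  also have "\<dots> = c * integral {0..1} (\<lambda>x. 1 / r x)" by (rule integral_mult_right)
  finally show ?thesis using integral_inverse_r_pos c[OF x] by simp
qed

lemma pot_deriv:
  assumes "continuous_on {0..1} f" "x \<in> {0..1}"
  shows "(pot f has_real_derivative flux f x / r x) (at x within {0..1})"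
  unfolding pot_def
  by (rule integral_has_real_derivative)
     (use assms in \<open>auto intro!: continuous_intros r_cont flux_cont simp: r_nz\<close>)

lemma green_deriv:
  assumes "continuous_on {0..1} f" "x \<in> {0..1}"
  shows "(green f has_real_derivative flux f x / r x) (at x within {0..1})"
  unfolding green_def
  using pot_deriv[OF assms] by (auto intro!: derivative_eq_intros)

lemma pot_cont: "continuous_on {0..1} f \<Longrightarrow> continuous_on {0..1} (pot f)"
  by (rule DERIV_continuous_on[OF pot_deriv])

lemma green_ends:
  assumes "continuous_on {0..1} f"
  shows "green f 1 = green f 0"
  using flux_mean[OF assms] by (simp add: green_def pot_def)

lemma green_mean_zero:
  assumes "continuous_on {0..1} f"
  shows "green f \<in> mean_zero"
proof -
  define c where "c = integral {0..1} (\<lambda>t. r t * pot f t) / integral {0..1} r"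
  have "integral {0..1} (\<lambda>x. r x * green f x) = integral {0..1} (\<lambda>x. r x * pot f x - c * r x)"
    by (simp add: green_def c_def algebra_simps)
  also have "\<dots> = integral {0..1} (\<lambda>x. r x * pot f x) - c * integral {0..1} r"
    by (subst integral_diff)
       (auto intro!: integrable_continuous_interval continuous_intros r_cont pot_cont assms)
  also have "\<dots> = 0" using integral_r_pos by (simp add: c_def)
  finally show ?thesis
    using DERIV_continuous_on[OF green_deriv[OF assms]] by (simp add: mean_zero_def)
qed

lemmas green_cont = green_mean_zero[THEN mean_zeroD(1)]

text \<open>As for \<open>flux_unique\<close>, but the additive constant is fixed by the weight r
  instead of 1 / r.\<close>

lemma green_unique:
  assumes f: "continuous_on {0..1} f"
    and u: "\<And>x. x \<in> {0..1} \<Longrightarrow> (u has_real_derivative flux f x / r x) (at x within {0..1})"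
    and m: "integral {0..1} (\<lambda>x. r x * u x) = 0" and x: "x \<in> {0..1}"
  shows "u x = green f x"
proof -
  have "\<exists>c. \<forall>x\<in>{0..1}. u x - green f x = c"
    by (rule has_field_derivative_zero_constant)
       (auto intro!: derivative_eq_intros u green_deriv f)
  then obtain c where c: "\<And>x. x \<in> {0..1} \<Longrightarrow> u x - green f x = c" by auto
  have "0 = integral {0..1} (\<lambda>x. r x * u x) - integral {0..1} (\<lambda>x. r x * green f x)"
    using m mean_zeroD(2)[OF green_mean_zero[OF f]] by simp
  also have "\<dots> = integral {0..1} (\<lambda>x. r x * u x - r x * green f x)"
    by (intro integral_diff[symmetric] integrable_continuous_interval continuous_intros r_cont
         green_cont f DERIV_continuous_on[OF u])
  also have "\<dots> = integral {0..1} (\<lambda>x. c * r x)"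
    by (intro integral_cong) (simp flip: c add: algebra_simps)
  also have "\<dots> = c * integral {0..1} r" by simp
  finally show ?thesis using integral_r_pos c[OF x] by simp
qed

text \<open>Linearity is stated for the combination f - c g because it covers both uses: c = 1 gives
  differences, and g = f with 1 - c for c gives multiples.\<close>

lemma mean_zero_diff:
  assumes "f \<in> mean_zero" "g \<in> mean_zero"
  shows "(\<lambda>x. f x - c * g x) \<in> mean_zero"
proof -
  have "integral {0..1} (\<lambda>x. r x * (f x - c * g x))
      = integral {0..1} (\<lambda>x. r x * f x - c * (r x * g x))"
    by (simp add: algebra_simps)
  also have "\<dots> = 0"
    using assms[THEN mean_zeroD(1)] assms[THEN mean_zeroD(2)]
    by (subst integral_diff) (auto intro!: integrable_continuous_interval continuous_intros r_cont)
  finally show ?thesis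
    using assms by (auto simp: mean_zero_def intro!: continuous_intros)
qed

lemma flux_diff:
  assumes f: "continuous_on {0..1} f" and g: "continuous_on {0..1} g" and x: "x \<in> {0..1}"
  shows "flux (\<lambda>x. f x - c * g x) x = flux f x - c * flux g x"
proof (rule flux_unique[symmetric, OF _ _ _ x])
  show "continuous_on {0..1} (\<lambda>x. f x - c * g x)" by (intro continuous_intros f g)
  show "((\<lambda>x. flux f x - c * flux g x) has_real_derivative - (r x * (f x - c * g x)))
      (at x within {0..1})" if "x \<in> {0..1}" for x
    by (rule derivative_eq_intros flux_deriv f g that refl | simp add: algebra_simps)+
  have "integral {0..1} (\<lambda>x. (flux f x - c * flux g x) / r x)
     = integral {0..1} (\<lambda>x. flux f x / r x - c * (flux g x / r x))"
    by (simp add: diff_divide_distrib)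
  also have "\<dots> = 0"
    using flux_mean[OF f] flux_mean[OF g]
    by (subst integral_diff)
       (auto intro!: integrable_continuous_interval continuous_intros r_cont flux_cont f g simp del: times_divide_eq_right)
  finally show "integral {0..1} (\<lambda>x. (flux f x - c * flux g x) / r x) = 0" .
qed

lemma green_diff:
  assumes f: "continuous_on {0..1} f" and g: "continuous_on {0..1} g" and x: "x \<in> {0..1}"
  shows "green (\<lambda>x. f x - c * g x) x = green f x - c * green g x"
proof (rule green_unique[symmetric, OF _ _ _ x])
  show "continuous_on {0..1} (\<lambda>x. f x - c * g x)" by (intro continuous_intros f g)
  show "((\<lambda>x. green f x - c * green g x) has_real_derivative flux (\<lambda>x. f x - c * g x) x / r x)
      (at x within {0..1})" if "x \<in> {0..1}" for x
    by (rule derivative_eq_intros green_deriv f g that refl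
       | simp add: flux_diff f g that[simplified] diff_divide_distrib)+
  show "integral {0..1} (\<lambda>x. r x * (green f x - c * green g x)) = 0"
    by (rule mean_zeroD(2)[OF mean_zero_diff[OF green_mean_zero[OF f] green_mean_zero[OF g]]])
qed

section \<open>The weighted inner product and the energy form\<close>

lemma ip_cong:
  "(\<And>x. x \<in> {0..1} \<Longrightarrow> f x = f' x) \<Longrightarrow> (\<And>x. x \<in> {0..1} \<Longrightarrow> g x = g' x) \<Longrightarrow> ip f g = ip f' g'"
  unfolding ip_def by (intro integral_cong) auto

lemma ip_integrable:
  assumes "continuous_on {0..1} f" "continuous_on {0..1} g"
  shows "(\<lambda>x. r x * f x * g x) integrable_on {0..1}"
  by (intro integrable_continuous_interval continuous_intros r_cont assms)

lemma ip_diff_diff: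
  assumes f: "continuous_on {0..1} f" and g: "continuous_on {0..1} g"
  shows "ip (\<lambda>x. f x - c * g x) (\<lambda>x. f x - c * g x) = ip f f - 2 * c * ip f g + c\<^sup>2 * ip g g"
proof -
  have "ip (\<lambda>x. f x - c * g x) (\<lambda>x. f x - c * g x) =
    integral {0..1} (\<lambda>x. r x * f x * f x - 2 * c * (r x * f x * g x) + c\<^sup>2 * (r x * g x * g x))"
    unfolding ip_def
    by (intro arg_cong[where f="integral {0..1}"] ext) (simp add: algebra_simps power2_eq_square)
  also have "\<dots> = ip f f - 2 * c * ip f g + c\<^sup>2 * ip g g"
    unfolding ip_def
    by (rule integral_linear_combination3[OF ip_integrable[OF f f] ip_integrable[OF f g] ip_integrable[OF g g]])
  finally show ?thesis .
qed

lemma ip_nonneg: "continuous_on {0..1} f \<Longrightarrow> 0 \<le> ip f f"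
  unfolding ip_def using ip_integrable[of f f]
  by (intro integral_nonneg) (auto simp: mult.assoc r_pos less_imp_le)

lemma ip_eq_0:
  assumes "continuous_on {0..1} f" "ip f f = 0" "x \<in> {0..1}"
  shows "f x = 0"
proof -
  have "\<forall>x\<in>{0..1}. r x * f x * f x = 0"
    using assms(2) unfolding ip_def
    by (subst (asm) integral_eq_0_iff)
       (auto intro!: continuous_intros r_cont assms(1) simp: mult.assoc r_pos less_imp_le)
  then show ?thesis using assms(3) r_nz[of x] by auto
qed

lemma ip_Cauchy_Schwarz:
  assumes "continuous_on {0..1} f" "continuous_on {0..1} g"
  shows "(ip f g)\<^sup>2 \<le> ip f f * ip g g"
  unfolding ip_def
  using assms r_cont r_pos by (intro weighted_Cauchy_Schwarz) (auto intro: less_imp_le)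

lemma energy_Cauchy_Schwarz:
  assumes "continuous_on {0..1} f" "continuous_on {0..1} g"
  shows "(energy f g)\<^sup>2 \<le> energy f f * energy g g"
  unfolding energy_def
  using assms r_pos
  by (intro weighted_Cauchy_Schwarz flux_cont continuous_intros r_cont) (auto intro: less_imp_le)

lemma energy_nonneg: "continuous_on {0..1} f \<Longrightarrow> 0 \<le> energy f f"
  unfolding energy_def
  by (intro integral_nonneg integrable_continuous_interval continuous_intros r_cont flux_cont)
     (auto simp: r_pos less_imp_le)

text \<open>Integration by parts on the product of \<open>green f\<close> and \<open>flux g\<close>.
  The boundary terms cancel: \<open>green f\<close> is periodic by construction, and
  \<open>flux g\<close> because g has mean zero. Thus \<open>energy\<close> is the quadratic form of
  the Green operator, which is therefore symmetric and nonnegative.\<close>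

lemma ip_green:
  assumes f: "continuous_on {0..1} f" and g: "g \<in> mean_zero"
  shows "ip (green f) g = energy f g"
proof -
  note g' = mean_zeroD(1)[OF g]
  have "integral {0..1} (\<lambda>x. 1 / r x * flux f x * flux g x - r x * green f x * g x)
      = green f 1 * flux g 1 - green f 0 * flux g 0"
  proof (rule integral_01_deriv[where F = "\<lambda>x. green f x * flux g x"])
    fix x :: real assume "x \<in> {0..1}"
    then show "((\<lambda>x. green f x * flux g x) has_real_derivative
        1 / r x * flux f x * flux g x - r x * green f x * g x) (at x within {0..1})"
      by (auto intro!: derivative_eq_intros green_deriv flux_deriv f g')
  qed
  also have "\<dots> = 0" using green_ends[OF f] flux_ends[OF g] by simp
  finally have "integral {0..1} (\<lambda>x. 1 / r x * flux f x * flux g x)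
      - integral {0..1} (\<lambda>x. r x * green f x * g x) = 0"
    by (subst (asm) integral_diff)
       (auto intro!: integrable_continuous_interval continuous_intros r_cont flux_cont green_cont f g')
  then show ?thesis by (simp add: ip_def energy_def)
qed

text \<open>A function whose mean against 1 / r is zero is bounded by its oscillation. The
  oscillation of \<open>flux f\<close> is at most the weighted L1 norm of f, which Cauchy-Schwarz
  bounds by the weighted L2 norm.\<close>

lemma flux_bound:
  assumes f: "continuous_on {0..1} f" and x: "x \<in> {0..1}"
  shows "\<bar>flux f x\<bar> \<le> sqrt (b * ip f f)"
proof -
  \<comment> \<open>The weighted L1 norm of f, written as an inner product with 1 so that
    Cauchy-Schwarz applies.\<close>
  define S where "S = ip (\<lambda>x. \<bar>f x\<bar>) (\<lambda>x. 1)"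
  have "S\<^sup>2 \<le> ip (\<lambda>x. \<bar>f x\<bar>) (\<lambda>x. \<bar>f x\<bar>) * ip (\<lambda>x. 1) (\<lambda>x. 1)"
    unfolding S_def by (intro ip_Cauchy_Schwarz continuous_intros f)
  also have "ip (\<lambda>x. \<bar>f x\<bar>) (\<lambda>x. \<bar>f x\<bar>) = ip f f"
    by (simp add: ip_def mult.assoc)
  also have "ip (\<lambda>x. 1) (\<lambda>x. 1) \<le> b"
    unfolding ip_def using integral_le[of r "{0..1}" "\<lambda>x. b"] r_bounds
    by (auto intro: integrable_continuous_interval r_cont)
  finally have S: "S\<^sup>2 \<le> b * ip f f"
    using ip_nonneg[OF f] by (smt (verit) mult.commute mult_left_mono)
  have osc: "flux f s - flux f t \<le> S" if "s \<in> {0..1}" "t \<in> {0..1}" for s t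
  proof -
    have int: "(\<lambda>x. r x * f x) integrable_on {u..v}" "(\<lambda>x. r x * \<bar>f x\<bar>) integrable_on {u..v}"
      if "{u..v} \<subseteq> {0..1}" for u v
      by (intro integrable_continuous_interval continuous_on_subset[OF _ that]
          continuous_intros r_cont f)+
    have *: "\<bar>integral {u..v} (\<lambda>x. r x * f x)\<bar> \<le> S" if "{u..v} \<subseteq> {0..1}" for u v
    proof -
      have "\<bar>integral {u..v} (\<lambda>x. r x * f x)\<bar> \<le> integral {u..v} (\<lambda>x. r x * \<bar>f x\<bar>)"
        unfolding real_norm_def[symmetric]
        by (rule integral_norm_bound_integral)
           (use int[OF that] that r_pos in \<open>auto simp: abs_mult subset_iff less_imp_le\<close>)
      also have "\<dots> \<le> integral {0..1} (\<lambda>x. r x * \<bar>f x\<bar>)"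
        using int[OF that] int[of 0 1] that r_pos by (intro integral_subset_le) (auto simp: less_imp_le)
      finally show ?thesis by (simp add: S_def ip_def)
    qed
    have split: "prim f v - prim f u = integral {u..v} (\<lambda>x. r x * f x)"
      if "0 \<le> u" "u \<le> v" "v \<le> 1" for u v
      unfolding prim_def
      using Henstock_Kurzweil_Integration.integral_combine[of 0 u v "\<lambda>x. r x * f x"] that
        int[of 0 v] by simp
    show ?thesis
    proof (cases "s \<le> t")
      case True
      then show ?thesis using split[of s t] *[of s t] that by (auto simp: flux_def)
    next
      case False
      then show ?thesis using split[of t s] *[of t s] that by (auto simp: flux_def)
    qed
  qed
  have Jr: "integral {0..1} (\<lambda>t. (flux f t + c) / r t) = c * integral {0..1} (\<lambda>t. 1 / r t)" for c
  proof -
    have "integral {0..1} (\<lambda>t. (flux f t + c) / r t)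
      = integral {0..1} (\<lambda>t. flux f t / r t + c * (1 / r t))"
      by (simp add: add_divide_distrib)
    also have "\<dots> = c * integral {0..1} (\<lambda>t. 1 / r t)"
      by (subst integral_add)
        (auto intro!: integrable_continuous_interval continuous_intros r_cont flux_cont f
           simp: flux_mean[OF f] simp del: times_divide_eq_right)
    finally show ?thesis .
  qed
  have *: "0 \<le> c" if "\<And>t. t \<in> {0..1} \<Longrightarrow> 0 \<le> flux f t + c" for c
  proof -
    have "0 \<le> integral {0..1} (\<lambda>t. (flux f t + c) / r t)"
      by (intro integral_nonneg integrable_continuous_interval continuous_intros r_cont flux_cont f)
         (use that r_pos in \<open>auto simp: less_imp_le\<close>)
    then show ?thesis
      using integral_inverse_r_pos by (simp add: Jr zero_le_mult_iff)
  qed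
  have **: "c \<le> 0" if "\<And>t. t \<in> {0..1} \<Longrightarrow> flux f t + c \<le> 0" for c
  proof -
    have "integral {0..1} (\<lambda>t. (flux f t + c) / r t) \<le> integral {0..1} (\<lambda>t::real. 0)"
      by (intro integral_le integrable_continuous_interval continuous_intros r_cont flux_cont f)
         (use that r_pos in \<open>auto simp: less_imp_le divide_nonpos_pos\<close>)
    then show ?thesis
      using integral_inverse_r_pos by (simp add: Jr mult_le_0_iff)
  qed
  \<comment> \<open>By \<open>osc\<close>, adding S - \<open>flux f x\<close> to
    \<open>flux f t\<close> gives something nonnegative for every t. Averaging against 1 / r removes
    \<open>flux f t\<close> and leaves the constant. The lower bound is symmetric.\<close>
  have "0 \<le> S - flux f x"
    by (rule *) (use osc[OF x] in \<open>force simp: algebra_simps\<close>)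
  moreover have "- S - flux f x \<le> 0"
    by (rule **) (use osc[OF _ x] in \<open>force simp: algebra_simps\<close>)
  ultimately have "\<bar>flux f x\<bar> \<le> S" by linarith
  also have "S \<le> sqrt (b * ip f f)" using S real_le_rsqrt by blast
  finally show ?thesis .
qed

text \<open>Pointwise, \<open>flux f\<close> squared is at most b * \<open>ip f f\<close> and 1 / r
  is at most 1 / a. This is the sole source of the bound b / a for M, hence of the final eigenvalue
  estimate.\<close>

lemma energy_le:
  assumes f: "continuous_on {0..1} f"
  shows "energy f f \<le> b / a * ip f f"
proof -
  have "energy f f \<le> integral {0..1} (\<lambda>x::real. 1 / a * (b * ip f f))"
    unfolding energy_def
  proof (intro integral_le integrable_continuous_interval continuous_intros r_cont flux_cont f)
    fix x :: real assume x: "x \<in> {0..1}"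
    have "(flux f x)\<^sup>2 \<le> (sqrt (b * ip f f))\<^sup>2"
      using power_mono[OF flux_bound[OF f x], of 2] by simp
    then have "flux f x * flux f x \<le> b * ip f f"
      using ip_nonneg[OF f] b_pos by (simp add: power2_eq_square)
    moreover have "1 / r x \<le> 1 / a"
      using r_bounds[OF x] a_pos by (intro divide_left_mono) auto
    ultimately show "1 / r x * flux f x * flux f x \<le> 1 / a * (b * ip f f)"
      using a_pos unfolding mult.assoc by (intro mult_mono[where c = "_ * _"]) auto
  qed auto
  then show ?thesis by simp
qed

text \<open>The mean value theorem with derivative \<open>flux f / r\<close>. It provides the
  equicontinuity for Arzela-Ascoli.\<close>

lemma green_Lipschitz:
  assumes f: "continuous_on {0..1} f" and "x \<in> {0..1}" "y \<in> {0..1}"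
  shows "\<bar>green f x - green f y\<bar> \<le> sqrt (b * ip f f) / a * \<bar>x - y\<bar>"
  unfolding real_norm_def[symmetric]
proof (rule field_differentiable_bound[OF _ green_deriv[OF f] _ assms(2,3)])
  fix z :: real assume z: "z \<in> {0..1}"
  have "\<bar>flux f z\<bar> / r z \<le> sqrt (b * ip f f) / a"
    using flux_bound[OF f z] r_bounds[OF z] a_pos b_pos ip_nonneg[OF f] by (intro frac_le) auto
  then show "norm (flux f z / r z) \<le> sqrt (b * ip f f) / a"
    using r_pos[OF z] by simp
qed auto

text \<open>As \<open>green f\<close> has r-weighted mean zero, its value at x is the weighted
  average over t of \<open>green f x - green f t\<close>, and each difference is at most the
  Lipschitz constant. Since only \<open>ip f f\<close> enters, \<open>green\<close> turns
  convergence in the weighted norm into uniform convergence.\<close>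

lemma green_bound:
  assumes f: "continuous_on {0..1} f" and x: "x \<in> {0..1}"
  shows "\<bar>green f x\<bar> \<le> sqrt (b * ip f f) / a"
proof -
  define L where "L = sqrt (b * ip f f) / a"
  have L: "\<bar>green f x - green f t\<bar> \<le> L" if "t \<in> {0..1}" for t
  proof -
    have "\<bar>green f x - green f t\<bar> \<le> L * \<bar>x - t\<bar>"
      unfolding L_def using green_Lipschitz f x that by blast
    also have "\<dots> \<le> L * 1"
      using x that a_pos b_pos ip_nonneg[OF f] by (intro mult_left_mono) (auto simp: L_def)
    finally show ?thesis by simp
  qed
  have Jr: "integral {0..1} (\<lambda>t. r t * (c - green f t)) = c * integral {0..1} r" for c
  proof -
    have "integral {0..1} (\<lambda>t. r t * (c - green f t)) = integral {0..1} (\<lambda>t. c * r t - r t * green f t)"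
      by (simp add: algebra_simps)
    also have "\<dots> = c * integral {0..1} r"
      by (subst integral_diff)
        (auto intro!: integrable_continuous_interval continuous_intros r_cont green_cont f
           simp: mean_zeroD(2)[OF green_mean_zero[OF f]])
    finally show ?thesis .
  qed
  have "\<bar>green f x\<bar> * integral {0..1} r = \<bar>integral {0..1} (\<lambda>t. r t * (green f x - green f t))\<bar>"
    using integral_r_pos by (simp add: Jr abs_mult)
  also have "\<dots> \<le> integral {0..1} (\<lambda>t. L * r t)"
    unfolding real_norm_def[symmetric]
  proof (rule integral_norm_bound_integral)
    show "norm (r t * (green f x - green f t)) \<le> L * r t" if "t \<in> {0..1}" for t
      using L[OF that] r_pos[OF that] by (simp add: abs_mult mult.commute)
  qed (auto intro!: integrable_continuous_interval continuous_intros r_cont green_cont f)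
  also have "\<dots> = L * integral {0..1} r" by simp
  finally show ?thesis using integral_r_pos unfolding L_def by (rule mult_right_le_imp_le)
qed

lemma ip_scale: "ip (\<lambda>x. c * f x) (\<lambda>x. c * f x) = c\<^sup>2 * ip f f"
proof -
  have "ip (\<lambda>x. c * f x) (\<lambda>x. c * f x) = integral {0..1} (\<lambda>x. c\<^sup>2 * (r x * f x * f x))"
    unfolding ip_def
    by (intro arg_cong[where f="integral {0..1}"] ext) (simp add: algebra_simps power2_eq_square)
  then show ?thesis by (simp add: ip_def)
qed

lemma mean_zero_scale: "f \<in> mean_zero \<Longrightarrow> (\<lambda>x. c * f x) \<in> mean_zero"
  using mean_zero_diff[of f f "1 - c"] by (simp add: algebra_simps)

lemma energy_scale:
  assumes "continuous_on {0..1} f"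
  shows "energy (\<lambda>x. c * f x) (\<lambda>x. c * f x) = c\<^sup>2 * energy f f"
proof -
  have *: "flux (\<lambda>x. c * f x) x = c * flux f x" if "x \<in> {0..1}" for x
    using flux_diff[OF assms assms that, of "1 - c"] by (simp add: algebra_simps)
  have "energy (\<lambda>x. c * f x) (\<lambda>x. c * f x)
      = integral {0..1} (\<lambda>x. c\<^sup>2 * (1 / r x * flux f x * flux f x))"
    unfolding energy_def by (intro integral_cong) (simp add: * power2_eq_square)
  then show ?thesis by (simp only: energy_def integral_mult_right)
qed

lemma ip_sup_bound:
  assumes g: "continuous_on {0..1} g" and e: "\<And>x. x \<in> {0..1} \<Longrightarrow> \<bar>g x\<bar> \<le> e"
  shows "ip g g \<le> b * e\<^sup>2"
proof -
  have "ip g g \<le> integral {0..1} (\<lambda>x::real. b * e\<^sup>2)"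
    unfolding ip_def
  proof (intro integral_le ip_integrable g)
    fix x :: real assume x: "x \<in> {0..1}"
    have "(g x)\<^sup>2 \<le> e\<^sup>2" using e[OF x] by (metis abs_ge_zero power2_abs power_mono)
    then show "r x * g x * g x \<le> b * e\<^sup>2"
      using r_bounds[OF x] b_pos
      by (simp add: mult.assoc mult_mono flip: power2_eq_square)
  qed auto
  then show ?thesis by simp
qed

text \<open>If the energy vanishes, so does the flux, and with it its derivative - r f. At interior
  points this derivative is two-sided, hence unique.\<close>

lemma energy_eq_0:
  assumes f: "continuous_on {0..1} f" and e: "energy f f = 0" and x: "0 < x" "x < 1"
  shows "f x = 0"
proof -
  have "\<forall>x\<in>{0..1}. 1 / r x * flux f x * flux f x = 0"
    using e unfolding energy_def
    by (subst (asm) integral_eq_0_iff)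
       (auto intro!: continuous_intros r_cont flux_cont f simp: r_pos less_imp_le)
  then have 0: "flux f y = 0" if "y \<in> {0..1}" for y using that r_nz[of y] by auto
  have "((\<lambda>_. 0) has_real_derivative - (r x * f x)) (at x within {0..1})"
    using x by (intro has_field_derivative_transform_within[OF flux_deriv[OF f], of x 1]) (auto simp: 0)
  then have "((\<lambda>_. 0) has_real_derivative - (r x * f x)) (at x)"
    using x by (simp add: at_within_Icc_at)
  from DERIV_unique[OF this DERIV_const] show ?thesis using x r_nz[of x] by simp
qed

text \<open>Guarantees that the supremum of the Rayleigh quotient is over a nonempty set and
  positive, so that 1 / M makes sense.\<close>

lemma exists_energy_pos: "\<exists>f\<in>mean_zero. 0 < energy f f \<and> ip f f = 1"
proof -
  define f where "f = (\<lambda>x. x - integral {0..1} (\<lambda>x. r x * x) / integral {0..1} r)"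
  have f: "f \<in> mean_zero"
  proof -
    define m where "m = integral {0..1} (\<lambda>x. r x * x) / integral {0..1} r"
    have "integral {0..1} (\<lambda>x. r x * f x) = integral {0..1} (\<lambda>x. r x * x - m * r x)"
      by (simp add: f_def m_def algebra_simps)
    also have "\<dots> = integral {0..1} (\<lambda>x. r x * x) - m * integral {0..1} r"
      by (subst integral_diff) (auto intro!: integrable_continuous_interval continuous_intros r_cont)
    also have "\<dots> = 0" using integral_r_pos by (simp add: m_def)
    finally show ?thesis by (auto simp: mean_zero_def f_def intro!: continuous_intros)
  qed
  note cf = mean_zeroD(1)[OF f]
  \<comment> \<open>f is the identity minus a constant, so it vanishes at no more than one of the
    two points.\<close>
  have "f (1/4) \<noteq> 0 \<or> f (3/4) \<noteq> 0" by (auto simp: f_def)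
  then have e: "0 < energy f f"
    using energy_eq_0[OF cf, of "1/4"] energy_eq_0[OF cf, of "3/4"] energy_nonneg[OF cf] by fastforce
  have "0 < ip f f"
    using e energy_le[OF cf] a_pos b_pos
    by (smt (verit) divide_pos_pos mult_nonneg_nonpos)
  then obtain c where c: "c\<^sup>2 * ip f f = 1"
    using that[of "1 / sqrt (ip f f)"] by (simp add: power_divide)
  show ?thesis
    using mean_zero_scale[OF f, of c] e energy_scale[OF cf, of c] ip_scale[of c f] c
    by (intro bexI[of _ "\<lambda>x. c * f x"]) (auto simp: zero_less_mult_iff)
qed

section \<open>Existence of a maximiser of the Rayleigh quotient\<close>

theorem green_top_eigenvalue:
  obtains M h where "0 < M" "M \<le> b / a" "h \<in> mean_zero" "\<exists>x\<in>{0..1}. h x \<noteq> 0"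
    "\<And>x. x \<in> {0..1} \<Longrightarrow> green h x = M * h x"
    "\<And>f. f \<in> mean_zero \<Longrightarrow> energy f f \<le> M * ip f f"
proof -
  define E where "E = (\<lambda>f. energy f f) ` {f \<in> mean_zero. ip f f = 1}"
  define M where "M = Sup E"
  have E_le: "e \<le> b / a" if "e \<in> E" for e
    using that energy_le mean_zeroD(1) by (fastforce simp: E_def)
  have bdd: "bdd_above E" using E_le by (rule bdd_aboveI)
  obtain f0 where f0: "f0 \<in> mean_zero" "0 < energy f0 f0" "ip f0 f0 = 1"
    using exists_energy_pos by blast
  have ne: "E \<noteq> {}" using f0 by (auto simp: E_def)
  have "energy f0 f0 \<le> M"
    unfolding M_def using f0 by (intro cSup_upper bdd) (auto simp: E_def)
  with f0 have M: "0 < M" by simp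
  have M_le: "M \<le> b / a" unfolding M_def using ne E_le by (rule cSup_least)
  have top: "energy f f \<le> M * ip f f" if f: "f \<in> mean_zero" for f
  proof (cases "ip f f = 0")
    case True
    then show ?thesis using energy_le[OF mean_zeroD(1)[OF f]] by simp
  next
    case False
    then have pos: "0 < ip f f" using ip_nonneg[OF mean_zeroD(1)[OF f]] by simp
    define c where "c = 1 / sqrt (ip f f)"
    have c: "c\<^sup>2 * ip f f = 1" using pos by (simp add: c_def power_divide)
    have "energy (\<lambda>x. c * f x) (\<lambda>x. c * f x) \<le> M"
      unfolding M_def using mean_zero_scale[OF f, of c]
      by (intro cSup_upper bdd) (auto simp: E_def ip_scale c)
    then have "c\<^sup>2 * energy f f \<le> M"
      by (simp only: energy_scale[OF mean_zeroD(1)[OF f]])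
    then have "(c\<^sup>2 * energy f f) * ip f f \<le> M * ip f f"
      using pos by (rule mult_right_mono[OF _ less_imp_le])
    also have "(c\<^sup>2 * energy f f) * ip f f = (c\<^sup>2 * ip f f) * energy f f"
      by algebra
    finally show ?thesis by (simp only: c mult_1_left)
  qed
  \<comment> \<open>The inequality ||K f||^2 <= M (K f, f). With q the left side, symmetry gives q =
    \<open>energy f (green f)\<close>; Cauchy-Schwarz for \<open>energy\<close> and
    \<open>top\<close> at \<open>green f\<close> then bound q^2 by \<open>energy f f\<close> times M
    q, and one factor q cancels.\<close>
  have green_le: "ip (green f) (green f) \<le> M * energy f f" if f: "f \<in> mean_zero" for f
  proof -
    note cf = mean_zeroD(1)[OF f]
    define q where "q = ip (green f) (green f)"
    have "q\<^sup>2 = (energy f (green f))\<^sup>2"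
      unfolding q_def by (simp add: ip_green[OF cf green_mean_zero[OF cf]])
    also have "\<dots> \<le> energy f f * energy (green f) (green f)"
      by (intro energy_Cauchy_Schwarz green_cont cf)
    also have "\<dots> \<le> energy f f * (M * q)"
      unfolding q_def by (intro mult_left_mono top green_mean_zero energy_nonneg cf)
    finally have *: "q * q \<le> (M * energy f f) * q" by (simp add: power2_eq_square algebra_simps)
    show ?thesis
    proof (cases "q = 0")
      case True
      then show ?thesis using M energy_nonneg[OF cf] by (simp add: q_def)
    next
      case False
      then have "0 < q" using ip_nonneg[OF green_cont[OF cf]] by (simp add: q_def)
      then show ?thesis using * by (simp add: q_def)
    qed
  qed
  have "\<exists>f\<in>mean_zero. ip f f = 1 \<and> M - 1 / real (Suc n) < energy f f" for n
  proof -
    have "M - 1 / real (Suc n) < Sup E" by (simp add: M_def)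
    then obtain e where "e \<in> E" "M - 1 / real (Suc n) < e" by (rule less_cSupE[OF _ ne])
    then show ?thesis unfolding E_def by blast
  qed
  then obtain f where f: "\<And>n. f n \<in> mean_zero" "\<And>n. ip (f n) (f n) = 1"
    "\<And>n. M - 1 / real (Suc n) < energy (f n) (f n)"
    by metis
  note cf = mean_zeroD(1)[OF f(1)]
  define g where "g = (\<lambda>n. green (f n))"
  have g: "g n \<in> mean_zero" for n unfolding g_def by (intro green_mean_zero cf)
  note cg = mean_zeroD(1)[OF g]
  define L where "L = sqrt b / a"
  have L: "0 < L" using a_pos b_pos by (simp add: L_def)
  have g_bound: "norm (g n x) \<le> L" if "x \<in> {0..1}" for n x
    using green_bound[OF cf that, of n] f(2) by (simp add: g_def L_def)
  have g_Lip: "norm (g n x - g n y) \<le> L * norm (x - y)" if "x \<in> {0..1}" "y \<in> {0..1}" for n x y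
    using green_Lipschitz[OF cf that, of n] f(2) by (simp add: g_def L_def)
  obtain h k where h: "continuous_on {0..1} h" and k: "strict_mono (k :: nat \<Rightarrow> nat)"
    and lim: "\<And>e. 0 < e \<Longrightarrow> \<exists>N. \<forall>n x. n \<ge> N \<and> x \<in> {0..1} \<longrightarrow> norm (g (k n) x - h x) < e"
  proof (rule Arzela_Ascoli[of "{0..1::real}" g L])
    show "\<exists>d>0. \<forall>n y. y \<in> {0..1} \<and> norm (x - y) < d \<longrightarrow> norm (g n x - g n y) < e"
      if "x \<in> {0..1}" "0 < e" for x e
    proof (intro exI[of _ "e / L"] conjI allI impI)
      show "0 < e / L" using that L by simp
      show "norm (g n x - g n y) < e" if "y \<in> {0..1} \<and> norm (x - y) < e / L" for n y
        using that g_Lip[OF \<open>x \<in> {0..1}\<close>, of y n] L by (simp add: field_simps)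
    qed
  qed (use g_bound in auto)
  \<comment> \<open>Uniform convergence implies convergence in the weighted norm. The factor 1
    mirrors the shape \<open>f x - c * g x\<close> of the linearity lemmas.\<close>
  have ip_lim: "\<exists>N. \<forall>n\<ge>N. ip (\<lambda>x. g (k n) x - 1 * h x) (\<lambda>x. g (k n) x - 1 * h x) \<le> b * e\<^sup>2"
    if "0 < e" for e
  proof -
    obtain N where N: "\<And>n x. n \<ge> N \<Longrightarrow> x \<in> {0..1} \<Longrightarrow> norm (g (k n) x - h x) < e"
      using lim[OF \<open>0 < e\<close>] by blast
    show ?thesis
      using N by (intro exI[of _ N] allI impI ip_sup_bound continuous_intros cg h)
        (auto intro: less_imp_le)
  qed
  have h0: "h \<in> mean_zero"
  proof -
    define z where "z = integral {0..1} (\<lambda>x. r x * h x)"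
    have "\<bar>z\<bar> \<le> b * e" if "0 < e" for e
    proof -
      obtain n where n: "ip (\<lambda>x. g (k n) x - 1 * h x) (\<lambda>x. g (k n) x - 1 * h x) \<le> b * e\<^sup>2"
        using ip_lim[OF \<open>0 < e\<close>] by blast
      have "ip (\<lambda>x. g (k n) x - 1 * h x) (\<lambda>x. 1)
        = integral {0..1} (\<lambda>x. r x * g (k n) x - r x * h x)"
        by (simp add: ip_def algebra_simps)
      also have "\<dots> = - z"
        unfolding z_def
        by (subst integral_diff)
           (auto intro!: integrable_continuous_interval continuous_intros r_cont cg h
              simp: mean_zeroD(2)[OF g])
      finally have "z\<^sup>2 = (ip (\<lambda>x. g (k n) x - 1 * h x) (\<lambda>x. 1))\<^sup>2" by simp
      also have "\<dots> \<le> (b * e\<^sup>2) * (b * 1\<^sup>2)"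
        using b_pos
        by (intro order_trans[OF ip_Cauchy_Schwarz] mult_mono n ip_sup_bound ip_nonneg
             continuous_intros cg h) auto
      finally have "z\<^sup>2 \<le> (b * e)\<^sup>2" by (simp add: power2_eq_square algebra_simps)
      then show ?thesis using b_pos that by (simp add: abs_le_square_iff[symmetric])
    qed
    \<comment> \<open>For this e the bound reads |z| <= |z| / 2.\<close>
    from this[of "\<bar>z\<bar> / (2 * b)"] have "z = 0" using b_pos by (cases "z = 0") auto
    then show ?thesis using h by (simp add: mean_zero_def z_def)
  qed
  \<comment> \<open>\<open>g n - M * f n\<close> is small only in the weighted norm. One more
    application of \<open>green\<close> makes the defect uniformly small and expresses it through
    \<open>g n\<close> alone, which has a convergent subsequence, whereas \<open>f n\<close> need
    not.\<close>
  have green_g: "\<bar>green (g n) x - M * g n x\<bar> \<le> sqrt (b * (M / real (Suc n))) / a"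
    if x: "x \<in> {0..1}" for n x
  proof -
    have "ip (g n) (g n) - 2 * M * ip (g n) (f n) + M\<^sup>2 * ip (f n) (f n)
       \<le> M * energy (f n) (f n) - 2 * M * energy (f n) (f n) + M\<^sup>2"
      using green_le[OF f(1)] by (simp add: g_def f(2) ip_green[OF cf f(1)])
    also have "\<dots> = M * (M - energy (f n) (f n))"
      by (simp add: power2_eq_square algebra_simps)
    also have "\<dots> \<le> M * (1 / real (Suc n))"
      using f(3)[of n] M by (intro mult_left_mono) auto
    finally have *: "ip (\<lambda>x. g n x - M * f n x) (\<lambda>x. g n x - M * f n x) \<le> M / real (Suc n)"
      by (simp add: ip_diff_diff[OF cg cf])
    have "\<bar>green (g n) x - M * g n x\<bar> = \<bar>green (\<lambda>x. g n x - M * f n x) x\<bar>"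
      by (simp add: green_diff[OF cg cf x]) (simp add: g_def)
    also have "\<dots> \<le> sqrt (b * ip (\<lambda>x. g n x - M * f n x) (\<lambda>x. g n x - M * f n x)) / a"
      by (intro green_bound x continuous_intros cg cf)
    also have "\<dots> \<le> sqrt (b * (M / real (Suc n))) / a"
      using * a_pos b_pos by (intro divide_right_mono real_sqrt_le_mono mult_left_mono) auto
    finally show ?thesis .
  qed
  \<comment> \<open>Two limits of \<open>green (g (k n)) x\<close> are compared: M * h x by
    \<open>green_g\<close>, and \<open>green h x\<close> because \<open>green_bound\<close> controls
    \<open>green\<close> of the difference \<open>g (k n) - h\<close>.\<close>
  have eig: "green h x = M * h x" if x: "x \<in> {0..1}" for x
  proof (rule LIMSEQ_unique)
    have g_lim: "(\<lambda>n. g (k n) x) \<longlonglongrightarrow> h x"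
      using lim x unfolding LIMSEQ_iff by blast
    have "(\<lambda>n. sqrt (b * (M / real (Suc n))) / a) \<longlonglongrightarrow> 0"
      using tendsto_divide[OF tendsto_real_sqrt[OF tendsto_mult_left[OF
            LIMSEQ_Suc[OF lim_const_over_n[of M]]]] tendsto_const[of a], of b] a_pos
      by simp
    from LIMSEQ_subseq_LIMSEQ[OF this k]
    have "(\<lambda>n. sqrt (b * (M / real (Suc (k n)))) / a) \<longlonglongrightarrow> 0" by (simp add: o_def)
    then have "(\<lambda>n. green (g (k n)) x - M * g (k n) x) \<longlonglongrightarrow> 0"
      by (rule Lim_null_comparison[rotated]) (use green_g[OF x] in auto)
    from tendsto_add[OF this tendsto_mult_left[OF g_lim, of M]]
    show "(\<lambda>n. green (g (k n)) x) \<longlonglongrightarrow> M * h x" by simp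
    show "(\<lambda>n. green (g (k n)) x) \<longlonglongrightarrow> green h x"
    proof (rule LIMSEQ_I)
      fix e :: real assume "0 < e"
      \<comment> \<open>Chosen so that the final bound b * d / a equals e / 2.\<close>
      define d where "d = e * a / (2 * b)"
      have d: "0 < d" using \<open>0 < e\<close> a_pos b_pos by (simp add: d_def)
      obtain N where N: "\<And>n. n \<ge> N \<Longrightarrow>
          ip (\<lambda>x. g (k n) x - 1 * h x) (\<lambda>x. g (k n) x - 1 * h x) \<le> b * d\<^sup>2"
        using ip_lim[OF d] by blast
      have "norm (green (g (k n)) x - green h x) < e" if "n \<ge> N" for n
      proof -
        have "norm (green (g (k n)) x - green h x) = \<bar>green (\<lambda>x. g (k n) x - 1 * h x) x\<bar>"
          by (simp add: green_diff[OF cg h x, where c = 1, simplified])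
        also have "\<dots> \<le> sqrt (b * ip (\<lambda>x. g (k n) x - 1 * h x) (\<lambda>x. g (k n) x - 1 * h x)) / a"
          by (intro green_bound x continuous_intros cg h)
        also have "\<dots> \<le> sqrt (b * (b * d\<^sup>2)) / a"
          using N[OF that] a_pos b_pos
          by (intro divide_right_mono real_sqrt_le_mono mult_left_mono) auto
        also have "b * (b * d\<^sup>2) = (b * d)\<^sup>2" by (simp add: power2_eq_square)
        also have "sqrt ((b * d)\<^sup>2) / a = e / 2" using b_pos a_pos \<open>0 < e\<close> by (simp add: d_def abs_mult)
        finally show ?thesis using \<open>0 < e\<close> by simp
      qed
      then show "\<exists>N. \<forall>n\<ge>N. norm (green (g (k n)) x - green h x) < e" by blast
    qed
  qed
  have nz: "\<exists>x\<in>{0..1}. h x \<noteq> 0"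
  proof (rule ccontr)
    assume "\<not> ?thesis"
    then have h0: "h x = 0" if "x \<in> {0..1}" for x using that by auto
    \<comment> \<open>If h were 0, the norm of \<open>g (k n)\<close> would tend to 0, and with it
      \<open>energy (f (k n)) (f (k n))\<close> = \<open>ip (g (k n)) (f (k n))\<close>, which tends
      to M. This d makes b * d^2 = (M / 4)^2, against an energy above M / 2.\<close>
    define d where "d = M / (2 * sqrt b) / 2"
    have d: "0 < d" using M b_pos by (simp add: d_def)
    obtain N where N: "\<And>n. n \<ge> N \<Longrightarrow>
        ip (\<lambda>x. g (k n) x - 1 * h x) (\<lambda>x. g (k n) x - 1 * h x) \<le> b * d\<^sup>2"
      using ip_lim[OF d] by blast
    obtain N' where N': "1 / real (Suc N') < M / 2"
      using M reals_Archimedean[of "M / 2"] by (auto simp: inverse_eq_divide)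
    define n where "n = max N N'"
    have "N' \<le> k n" using seq_suble[OF k, of n] by (simp add: n_def)
    then have "1 / real (Suc (k n)) \<le> 1 / real (Suc N')" by (intro divide_left_mono) auto
    then have e: "M / 2 < energy (f (k n)) (f (k n))" using f(3)[of "k n"] N' by linarith
    have "(energy (f (k n)) (f (k n)))\<^sup>2 = (ip (g (k n)) (f (k n)))\<^sup>2"
      by (simp add: g_def ip_green[OF cf f(1)])
    also have "\<dots> \<le> ip (g (k n)) (g (k n)) * ip (f (k n)) (f (k n))"
      by (intro ip_Cauchy_Schwarz cg cf)
    also have "\<dots> = ip (\<lambda>x. g (k n) x - 1 * h x) (\<lambda>x. g (k n) x - 1 * h x)"
      using h0 by (auto simp: f(2) intro!: ip_cong)
    also have "\<dots> \<le> b * d\<^sup>2" using N by (simp add: n_def)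
    also have "\<dots> = (M / 4)\<^sup>2" using b_pos by (simp add: d_def power2_eq_square)
    finally have "energy (f (k n)) (f (k n)) \<le> M / 4"
      using M by (simp add: power2_le_iff_abs_le)
    then show False using e M by simp
  qed
  show ?thesis by (rule that[OF M M_le h0 nz eig top])
qed

end

section \<open>Smooth functions of one coordinate\<close>

text \<open>Lets regularity be checked on an explicit derivative in place of the choice operator
  \<open>frechet_derivative\<close>.\<close>

lemma C_times_SucI:
  assumes "\<And>x. (f has_derivative f' x) (at x)" "\<And>v. C_times k (\<lambda>x. f' x v)"
  shows "C_times (Suc k) f"
proof -
  have "frechet_derivative f (at x) = f' x" for x
    using assms(1) by (metis frechet_derivative_at)
  then show ?thesis using assms by (auto simp: differentiable_def)
qed

lemma C_times_SucD:
  assumes "C_times (Suc k) f"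
  shows "(f has_derivative frechet_derivative f (at x)) (at x)"
    "C_times k (\<lambda>x. frechet_derivative f (at x) v)"
  using assms by (auto simp: frechet_derivative_works)

lemma C_times_Suc_imp: "C_times (Suc k) f \<Longrightarrow> C_times k f"
proof (induction k arbitrary: f)
  case 0
  then show ?case
    by (auto intro!: continuous_at_imp_continuous_on differentiable_imp_continuous_within)
next
  case (Suc k)
  show ?case
    by (rule C_times_SucI[OF C_times_SucD(1)[OF Suc.prems] Suc.IH[OF C_times_SucD(2)[OF Suc.prems]]])
qed

lemma C_times_const: "C_times k (\<lambda>x. c)"
proof (induction k arbitrary: c)
  case (Suc k)
  show ?case by (rule C_times_SucI[OF has_derivative_const Suc.IH])
qed (simp add: continuous_on_const)

lemma C_times_add: "C_times k f \<Longrightarrow> C_times k g \<Longrightarrow> C_times k (\<lambda>x. f x + g x)"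
proof (induction k arbitrary: f g)
  case (Suc k)
  show ?case
    by (rule C_times_SucI[OF has_derivative_add[OF Suc.prems[THEN C_times_SucD(1)]]])
       (intro Suc.IH C_times_SucD(2) Suc.prems)
qed (auto intro: continuous_on_add)

text \<open>The product rule pairs one differentiated factor with one undifferentiated factor, so
  the induction also needs f and g at the lower order, from \<open>C_times_Suc_imp\<close>.\<close>

lemma C_times_bilinear:
  assumes B: "bounded_bilinear B"
  shows "C_times k f \<Longrightarrow> C_times k g \<Longrightarrow> C_times k (\<lambda>x. B (f x) (g x))"
proof (induction k arbitrary: f g)
  case (Suc k)
  note low = Suc.prems[THEN C_times_Suc_imp] and deriv = Suc.prems[THEN C_times_SucD(2)]
  show ?case
    by (rule C_times_SucI[OF bounded_bilinear.FDERIV[OF B Suc.prems[THEN C_times_SucD(1)]]])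
       (rule C_times_add Suc.IH low deriv)+
qed (auto intro: bounded_bilinear.continuous_on[OF B])

lemmas C_times_scaleR = C_times_bilinear[OF bounded_bilinear_scaleR]
lemmas C_times_mult = C_times_bilinear[OF bounded_bilinear_mult]

lemma has_derivative_coordinate:
  fixes \<phi> :: "real \<Rightarrow> real" and x :: "real ^ 'n"
  assumes "(\<phi> has_real_derivative d) (at (x $ i))"
  shows "((\<lambda>x. \<phi> (x $ i)) has_derivative (\<lambda>v. v $ i * d)) (at x)"
proof -
  have "((\<lambda>x. x $ i) has_derivative (\<lambda>v. v $ i)) (at x)"
    by (rule bounded_linear_imp_has_derivative[OF bounded_linear_vec_nth])
  from DERIV_compose_FDERIV[OF assms this] show ?thesis .
qed

lemma bounded_linear_imp_C_times:
  assumes "bounded_linear f"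
  shows "C_times k f"
proof (cases k)
  case 0
  then show ?thesis using assms by (simp add: linear_continuous_on)
next
  case (Suc n)
  show ?thesis
    unfolding Suc
    by (rule C_times_SucI[OF bounded_linear_imp_has_derivative[OF assms] C_times_const])
qed

lemma C_times_coordinate_SucI:
  fixes \<phi> \<psi> :: "real \<Rightarrow> real"
  assumes "\<And>t. (\<phi> has_real_derivative \<psi> t) (at t)" "C_times k (\<lambda>x :: real ^ 'n. \<psi> (x $ i))"
  shows "C_times (Suc k) (\<lambda>x :: real ^ 'n. \<phi> (x $ i))"
  by (rule C_times_SucI[OF has_derivative_coordinate[OF assms(1)]])
     (intro C_times_mult C_times_const assms(2))

lemma C_times_0_coordinate:
  fixes \<phi> \<psi> :: "real \<Rightarrow> real"
  assumes "\<And>t. (\<phi> has_real_derivative \<psi> t) (at t)"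
  shows "C_times 0 (\<lambda>x :: real ^ 'n. \<phi> (x $ i))"
proof -
  have "continuous_on UNIV \<phi>" by (rule DERIV_continuous_on[of UNIV \<phi> \<psi>]) (simp add: assms)
  then show ?thesis
    by (auto intro!: continuous_intros continuous_on_compose2[of UNIV \<phi>])
qed

text \<open>Both functions go through one induction because each is, up to a factor, the derivative
  of the other.\<close>

lemma C_times_sin_cos:
  "C_times k (\<lambda>x :: real ^ 'n. sin (c * x $ i)) \<and> C_times k (\<lambda>x :: real ^ 'n. cos (c * x $ i))"
proof (induction k)
  case (Suc k)
  have s: "((\<lambda>t. sin (c * t)) has_real_derivative c * cos (c * t)) (at t)"
   and c: "((\<lambda>t. cos (c * t)) has_real_derivative - c * sin (c * t)) (at t)" for t
    by (auto intro!: derivative_eq_intros)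
  show ?case
    by (intro conjI C_times_coordinate_SucI[OF s] C_times_coordinate_SucI[OF c]
         C_times_mult C_times_const Suc.IH[THEN conjunct1] Suc.IH[THEN conjunct2])
qed (auto intro!: continuous_intros)

lemmas C_times_sin = C_times_sin_cos[THEN conjunct1]
lemmas C_times_cos = C_times_sin_cos[THEN conjunct2]


section \<open>Tori of revolution\<close>

definition integer_periodic :: "(real ^ 2 \<Rightarrow> 'b) \<Rightarrow> bool" where
  "integer_periodic F \<longleftrightarrow> (\<forall>x y. (\<forall>i. y $ i - x $ i \<in> \<int>) \<longrightarrow> F x = F y)"

lemma abs_rep_torus2 [simp]: "abs_torus2 (rep_torus2 p) = p"
  by (rule Quotient3_abs_rep[OF Quotient3_torus2])

text \<open>Maps on the torus are built by evaluating a formula at the representative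
  \<open>rep_torus2\<close>, an arbitrary choice. Periodicity makes the choice invisible and gives
  back the formula in the covering plane.\<close>

lemma descend:
  assumes "integer_periodic F"
  shows "F (rep_torus2 (abs_torus2 x)) = F x"
proof -
  have "abs_torus2 x = abs_torus2 (rep_torus2 (abs_torus2 x))" by simp
  then have "\<forall>i. rep_torus2 (abs_torus2 x) $ i - x $ i \<in> \<int>"
    unfolding torus2.abs_eq_iff .
  then show ?thesis using assms by (metis integer_periodic_def)
qed

lemma sin_cos_2pi_eq_iff:
  "sin (2 * pi * s) = sin (2 * pi * t) \<and> cos (2 * pi * s) = cos (2 * pi * t) \<longleftrightarrow> s - t \<in> \<int>"
proof -
  have "2 * pi * s = 2 * pi * t + 2 * pi * real_of_int n \<longleftrightarrow> s - t = of_int n" for n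
  proof -
    have "2 * pi * s = 2 * pi * t + 2 * pi * real_of_int n \<longleftrightarrow> (2 * pi) * s = (2 * pi) * (t + of_int n)"
      by (simp add: algebra_simps)
    also have "\<dots> \<longleftrightarrow> s = t + of_int n" by simp
    finally show ?thesis by auto
  qed
  then show ?thesis by (auto simp: sin_cos_eq_iff elim: Ints_cases)
qed

text \<open>2 pi times the distance from the axis. This is the length of the parallel at t, hence
  the weight of the one-dimensional problem.\<close>

definition radius :: "real \<Rightarrow> real \<Rightarrow> real" where
  "radius A t = A + cos (2 * pi * t)"

text \<open>The factor 1 / (2 pi) cancels the 2 pi produced by differentiating the angles, so that
  the generating circle has unit speed. The sum of scaled axis vectors lets the closure rules of
  \<open>C_times\<close> apply.\<close>

definition embedding_coords :: "real \<Rightarrow> real ^ 2 \<Rightarrow> real ^ 3" where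
  "embedding_coords A x =
     (1 / (2 * pi) * (radius A (x $ 1) * cos (2 * pi * x $ 2))) *\<^sub>R axis 1 1 +
     (1 / (2 * pi) * (radius A (x $ 1) * sin (2 * pi * x $ 2))) *\<^sub>R axis 2 1 +
     (1 / (2 * pi) * sin (2 * pi * x $ 1)) *\<^sub>R axis 3 1"

text \<open>The diagonal matrix with entries 1 and r^2: \<open>axis 1 (axis 1 1)\<close> and
  \<open>axis 2 (axis 2 1)\<close> are matrix units.\<close>

definition metric_coords :: "real \<Rightarrow> real ^ 2 \<Rightarrow> real ^ 2 ^ 2" where
  "metric_coords A x = axis 1 (axis 1 1) + (radius A (x $ 1))\<^sup>2 *\<^sub>R axis 2 (axis 2 1)"

lemma embedding_coords_nth [simp]:
  "embedding_coords A x $ 1 = radius A (x $ 1) * cos (2 * pi * x $ 2) / (2 * pi)"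
  "embedding_coords A x $ 2 = radius A (x $ 1) * sin (2 * pi * x $ 2) / (2 * pi)"
  "embedding_coords A x $ 3 = sin (2 * pi * x $ 1) / (2 * pi)"
  by (simp_all add: embedding_coords_def axis_def)

lemma metric_coords_nth [simp]:
  "metric_coords A x $ 1 $ 1 = 1" "metric_coords A x $ 1 $ 2 = 0"
  "metric_coords A x $ 2 $ 1 = 0" "metric_coords A x $ 2 $ 2 = (radius A (x $ 1))\<^sup>2"
  by (simp_all add: metric_coords_def axis_def)

lemma C_times_radius: "C_times k (\<lambda>x :: real ^ 'n. radius A (x $ i))"
  unfolding radius_def by (intro C_times_add C_times_const C_times_cos)

lemma smooth_embedding_coords: "smooth (embedding_coords A)"
  unfolding smooth_def embedding_coords_def
  by (intro allI C_times_add C_times_scaleR C_times_mult C_times_const C_times_radius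
      C_times_sin C_times_cos)

lemma smooth_metric_coords: "smooth (metric_coords A)"
  unfolding smooth_def metric_coords_def power2_eq_square
  by (intro allI C_times_add C_times_scaleR C_times_mult C_times_const C_times_radius)

lemma radius_periodic: "s - t \<in> \<int> \<Longrightarrow> radius A s = radius A t"
  using sin_cos_2pi_eq_iff[of s t] by (simp add: radius_def)

lemma vec_2_eq_iff: "x = y \<longleftrightarrow> x $ 1 = y $ 1 \<and> x $ 2 = y $ (2 :: 2)"
  by (simp add: vec_eq_iff forall_2)

lemma vec_3_eq_iff: "x = y \<longleftrightarrow> x $ 1 = y $ 1 \<and> x $ 2 = y $ 2 \<and> x $ 3 = y $ (3 :: 3)"
  by (simp add: vec_eq_iff forall_3)

text \<open>The first two coordinates determine the square of the radius, hence the radius, as 1 < A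
  makes it positive. The radius gives the cosine of the first angle and the third coordinate its
  sine; dividing by the radius gives the second angle.\<close>

lemma embedding_coords_eq_iff:
  assumes "1 < A"
  shows "embedding_coords A x = embedding_coords A y \<longleftrightarrow> (\<forall>i. y $ i - x $ i \<in> \<int>)"
proof
  assume eq: "embedding_coords A x = embedding_coords A y"
  define R S where "R = radius A (x $ 1)" and "S = radius A (y $ 1)"
  have pos: "0 < R" "0 < S"
    using assms cos_ge_minus_one[of "2 * pi * x $ 1"] cos_ge_minus_one[of "2 * pi * y $ 1"]
    by (simp_all add: radius_def R_def S_def del: cos_ge_minus_one)
  have e: "R * cos (2 * pi * x $ 2) = S * cos (2 * pi * y $ 2)"
    "R * sin (2 * pi * x $ 2) = S * sin (2 * pi * y $ 2)"
    "sin (2 * pi * x $ 1) = sin (2 * pi * y $ 1)"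
    using eq by (simp_all add: vec_3_eq_iff R_def S_def)
  have "R\<^sup>2 = (R * cos (2 * pi * x $ 2))\<^sup>2 + (R * sin (2 * pi * x $ 2))\<^sup>2"
    by (simp add: power_mult_distrib flip: distrib_left)
  also have "\<dots> = S\<^sup>2"
    unfolding e by (simp add: power_mult_distrib flip: distrib_left)
  finally have RS: "R = S" using pos by (simp add: power2_eq_iff)
  then have "cos (2 * pi * x $ 1) = cos (2 * pi * y $ 1)" by (simp add: R_def S_def radius_def)
  then have "y $ 1 - x $ 1 \<in> \<int>"
    using e sin_cos_2pi_eq_iff by metis
  moreover have "y $ 2 - x $ 2 \<in> \<int>"
    using e RS pos by (simp flip: sin_cos_2pi_eq_iff)
  ultimately show "\<forall>i. y $ i - x $ i \<in> \<int>" by (simp add: forall_2)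
next
  assume "\<forall>i. y $ i - x $ i \<in> \<int>"
  then have "y $ 1 - x $ 1 \<in> \<int>" "y $ 2 - x $ 2 \<in> \<int>" by auto
  then show "embedding_coords A x = embedding_coords A y"
    unfolding sin_cos_2pi_eq_iff[symmetric] by (simp add: vec_3_eq_iff radius_def)
qed

lemma embedding_coords_periodic: "1 < A \<Longrightarrow> integer_periodic (embedding_coords A)"
  by (simp add: integer_periodic_def embedding_coords_eq_iff)

lemma metric_coords_periodic: "integer_periodic (metric_coords A)"
  unfolding integer_periodic_def metric_coords_def using radius_periodic by metis

lemma radius_deriv: "(radius A has_real_derivative - 2 * pi * sin (2 * pi * t)) (at t)"
  unfolding radius_def by (auto intro!: derivative_eq_intros)

definition embedding_coords_deriv :: "real \<Rightarrow> real ^ 2 \<Rightarrow> real ^ 2 \<Rightarrow> real ^ 3" where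
  "embedding_coords_deriv A x v =
     (- sin (2 * pi * x $ 1) * cos (2 * pi * x $ 2) * v $ 1
      - radius A (x $ 1) * sin (2 * pi * x $ 2) * v $ 2) *\<^sub>R axis 1 1 +
     (- sin (2 * pi * x $ 1) * sin (2 * pi * x $ 2) * v $ 1
      + radius A (x $ 1) * cos (2 * pi * x $ 2) * v $ 2) *\<^sub>R axis 2 1 +
     (cos (2 * pi * x $ 1) * v $ 1) *\<^sub>R axis 3 1"

lemma embedding_coords_has_derivative:
  "(embedding_coords A has_derivative embedding_coords_deriv A x) (at x)"
proof -
  have s: "((\<lambda>t. sin (2 * pi * t)) has_real_derivative 2 * pi * cos (2 * pi * t)) (at t)"
   and c: "((\<lambda>t. cos (2 * pi * t)) has_real_derivative - 2 * pi * sin (2 * pi * t)) (at t)" for t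
    by (auto intro!: derivative_eq_intros)
  note d = has_derivative_mult_right[OF has_derivative_mult[OF has_derivative_coordinate[OF radius_deriv]
      has_derivative_coordinate]]
  have 1: "((\<lambda>x. 1 / (2 * pi) * (radius A (x $ 1) * cos (2 * pi * x $ 2))) has_derivative
      (\<lambda>v. - sin (2 * pi * x $ 1) * cos (2 * pi * x $ 2) * v $ 1
        - radius A (x $ 1) * sin (2 * pi * x $ 2) * v $ 2)) (at x)"
    by (rule has_derivative_eq_rhs[OF d[OF c]]) (simp add: fun_eq_iff field_simps)
  have 2: "((\<lambda>x. 1 / (2 * pi) * (radius A (x $ 1) * sin (2 * pi * x $ 2))) has_derivative
      (\<lambda>v. - sin (2 * pi * x $ 1) * sin (2 * pi * x $ 2) * v $ 1
        + radius A (x $ 1) * cos (2 * pi * x $ 2) * v $ 2)) (at x)"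
    by (rule has_derivative_eq_rhs[OF d[OF s]]) (simp add: fun_eq_iff field_simps)
  have 3: "((\<lambda>x. 1 / (2 * pi) * sin (2 * pi * x $ 1)) has_derivative
      (\<lambda>v. cos (2 * pi * x $ 1) * v $ 1)) (at x)"
    by (rule has_derivative_eq_rhs[OF has_derivative_mult_right[OF has_derivative_coordinate[OF s]]])
       (simp add: fun_eq_iff field_simps)
  show ?thesis
    unfolding embedding_coords_def embedding_coords_deriv_def
    by (intro has_derivative_add has_derivative_scaleR_left 1 2 3)
qed

lemma inner_embedding_coords_deriv:
  "embedding_coords_deriv A x v \<bullet> embedding_coords_deriv A x w = v \<bullet> (metric_coords A x *v w)"
proof -
  define s1 c1 s2 c2 where "s1 = sin (2 * pi * x $ 1)" "c1 = cos (2 * pi * x $ 1)"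
    "s2 = sin (2 * pi * x $ 2)" "c2 = cos (2 * pi * x $ 2)"
  have e: "s1\<^sup>2 + c1\<^sup>2 = 1" "s2\<^sup>2 + c2\<^sup>2 = 1"
    by (simp_all add: s1_c1_s2_c2_def)
  have "embedding_coords_deriv A x v \<bullet> embedding_coords_deriv A x w
    = (- s1 * c2 * v $ 1 - radius A (x $ 1) * s2 * v $ 2) * (- s1 * c2 * w $ 1 - radius A (x $ 1) * s2 * w $ 2)
      + (- s1 * s2 * v $ 1 + radius A (x $ 1) * c2 * v $ 2) * (- s1 * s2 * w $ 1 + radius A (x $ 1) * c2 * w $ 2)
      + (c1 * v $ 1) * (c1 * w $ 1)"
    by (simp add: inner_vec_def sum_3 embedding_coords_deriv_def axis_def flip: s1_c1_s2_c2_def)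
  also have "\<dots> = (s1\<^sup>2 * (s2\<^sup>2 + c2\<^sup>2) + c1\<^sup>2) * (v $ 1 * w $ 1)
      + (radius A (x $ 1))\<^sup>2 * (s2\<^sup>2 + c2\<^sup>2) * (v $ 2 * w $ 2)"
    by (simp add: power2_eq_square algebra_simps)
  also have "\<dots> = v \<bullet> (metric_coords A x *v w)"
    by (simp add: e inner_vec_def sum_2 matrix_vector_mult_def)
  finally show ?thesis .
qed

section \<open>Rotations about the third axis\<close>

definition rotation_z :: "real \<Rightarrow> real ^ 3 ^ 3" where
  "rotation_z t = vector [vector [cos t, - sin t, 0], vector [sin t, cos t, 0], vector [0, 0, 1]]"

lemma rotation_z_nth [simp]:
  "rotation_z t $ 1 $ 1 = cos t" "rotation_z t $ 1 $ 2 = - sin t" "rotation_z t $ 1 $ 3 = 0"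
  "rotation_z t $ 2 $ 1 = sin t" "rotation_z t $ 2 $ 2 = cos t" "rotation_z t $ 2 $ 3 = 0"
  "rotation_z t $ 3 $ 1 = 0" "rotation_z t $ 3 $ 2 = 0" "rotation_z t $ 3 $ 3 = 1"
  by (simp_all add: rotation_z_def)

text \<open>The induced action is defined from all rotations fixing the axis, so these have to be
  classified. The fixed vector gives the last column, the norm of the last row then clears that row,
  and a 2 x 2 rotation block remains.\<close>

lemma rotation_matrix_fixing_axis3_iff:
  "rotation_matrix Q \<and> Q *v axis 3 1 = axis 3 1 \<longleftrightarrow> (\<exists>t. Q = rotation_z t)"
proof
  assume Q: "rotation_matrix Q \<and> Q *v axis 3 1 = axis 3 1"
  have col: "Q $ 1 $ 3 = 0" "Q $ 2 $ 3 = 0" "Q $ 3 $ 3 = 1"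
    using Q by (simp_all add: vec_3_eq_iff matrix_vector_mult_def sum_3 axis_def)
  have o: "Q ** transpose Q = mat 1" "transpose Q ** Q = mat 1" and d: "det Q = 1"
    using Q by (simp_all add: rotation_matrix_def orthogonal_matrix_def)
  have "(Q $ 3 $ 1)\<^sup>2 + (Q $ 3 $ 2)\<^sup>2 = 0"
    using o(1) col by (simp add: vec_3_eq_iff matrix_matrix_mult_def transpose_def sum_3 mat_def power2_eq_square)
  then have row: "Q $ 3 $ 1 = 0" "Q $ 3 $ 2 = 0" by (simp_all add: sum_power2_eq_zero_iff)
  have n: "(Q $ 1 $ 1)\<^sup>2 + (Q $ 2 $ 1)\<^sup>2 = 1" "(Q $ 1 $ 2)\<^sup>2 + (Q $ 2 $ 2)\<^sup>2 = 1"
    using o(2) row by (simp_all add: vec_3_eq_iff matrix_matrix_mult_def transpose_def sum_3 mat_def power2_eq_square)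
  have "Q $ 1 $ 1 * Q $ 2 $ 2 - Q $ 1 $ 2 * Q $ 2 $ 1 = 1"
    using d row col by (simp add: det_3)
  \<comment> \<open>The left side is the sum of the squared column norms of the block minus twice
    its determinant, that is 1 + 1 - 2.\<close>
  then have "(Q $ 2 $ 2 - Q $ 1 $ 1)\<^sup>2 + (Q $ 1 $ 2 + Q $ 2 $ 1)\<^sup>2 = 0"
    using n by (simp add: power2_eq_square algebra_simps)
  then have "Q $ 2 $ 2 = Q $ 1 $ 1" "Q $ 1 $ 2 = - Q $ 2 $ 1"
    by (simp_all add: sum_power2_eq_zero_iff)
  moreover obtain t where "Q $ 1 $ 1 = cos t" "Q $ 2 $ 1 = sin t"
    using sincos_total_2pi_le[OF n(1)] by blast
  ultimately show "\<exists>t. Q = rotation_z t"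
    using row col by (intro exI[of _ t]) (simp add: vec_3_eq_iff)
next
  assume "\<exists>t. Q = rotation_z t"
  then obtain t where Q: "Q = rotation_z t" by blast
  show "rotation_matrix Q \<and> Q *v axis 3 1 = axis 3 1"
    by (simp add: Q rotation_matrix_def orthogonal_matrix det_3 vec_3_eq_iff matrix_matrix_mult_def
       matrix_vector_mult_def transpose_def sum_3 mat_def axis_def flip: power2_eq_square)
qed

text \<open>Measuring the angle in full turns makes s the translation of the second covering
  coordinate.\<close>

lemma rotations_about_axis3:
  "rotations_about 0 (axis 3 1) = range (\<lambda>s x. rotation_z (2 * pi * s) *v x)"
proof -
  have "rotations_about 0 (axis 3 1) = (\<lambda>Q x. Q *v x) ` {Q. rotation_matrix Q \<and> Q *v axis 3 1 = axis 3 1}"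
    by (auto simp: rotations_about_def)
  also have "{Q. rotation_matrix Q \<and> Q *v axis 3 1 = axis 3 1} = range (\<lambda>s. rotation_z (2 * pi * s))"
  proof -
    have "rotation_z t = rotation_z (2 * pi * (t / (2 * pi)))" for t by simp
    then show ?thesis unfolding rotation_matrix_fixing_axis3_iff by blast
  qed
  finally show ?thesis by (simp add: image_image)
qed

lemma rotation_z_embedding_coords:
  "rotation_z (2 * pi * s) *v embedding_coords A x = embedding_coords A (x + s *\<^sub>R axis 2 1)"
  by (simp add: vec_3_eq_iff matrix_vector_mult_def sum_3 axis_def distrib_left cos_add sin_add
     field_simps)

section \<open>Descent to the quotient torus\<close>

definition torus_embedding :: "real \<Rightarrow> torus2 \<Rightarrow> real ^ 3" where
  "torus_embedding A p = embedding_coords A (rep_torus2 p)"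

definition torus_metric :: "real \<Rightarrow> torus2 \<Rightarrow> real ^ 2 ^ 2" where
  "torus_metric A p = metric_coords A (rep_torus2 p)"

definition rotate :: "real \<Rightarrow> torus2 \<Rightarrow> torus2" where
  "rotate s p = abs_torus2 (rep_torus2 p + s *\<^sub>R axis 2 1)"

lemma torus_metric_abs [simp]: "torus_metric A (abs_torus2 x) = metric_coords A x"
  by (simp add: torus_metric_def descend[OF metric_coords_periodic])

lemma torus_embedding_abs [simp]: "1 < A \<Longrightarrow> torus_embedding A (abs_torus2 x) = embedding_coords A x"
  by (simp add: torus_embedding_def descend[OF embedding_coords_periodic])

lemma rotate_abs [simp]: "rotate s (abs_torus2 x) = abs_torus2 (x + s *\<^sub>R axis 2 1)"
  unfolding rotate_def
  by (rule descend[of "\<lambda>x. abs_torus2 (x + s *\<^sub>R axis 2 1)"])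
     (simp add: integer_periodic_def torus2.abs_eq_iff)

lemma torus2_cases: obtains x where "p = abs_torus2 x"
  by (metis abs_rep_torus2)

lemma torus_embedding_rotate: "1 < A \<Longrightarrow> rotation_z (2 * pi * s) *v torus_embedding A p = torus_embedding A (rotate s p)"
  by (cases p rule: torus2_cases) (simp add: rotation_z_embedding_coords)

lemma inj_torus_embedding:
  assumes "1 < A"
  shows "inj (torus_embedding A)"
proof (rule injI)
  fix p q assume "torus_embedding A p = torus_embedding A q"
  then show "p = q"
    using assms
    by (cases p rule: torus2_cases; cases q rule: torus2_cases)
       (simp add: embedding_coords_eq_iff torus2.abs_eq_iff)
qed

text \<open>A rotated point of the image lies in the image again, where \<open>inv\<close> is a
  genuine inverse of the injective embedding.\<close>

lemma induced_action_torus_embedding: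
  assumes "1 < A"
  shows "induced_action 0 (axis 3 1) (torus_embedding A) = range rotate"
proof -
  have "induced_action 0 (axis 3 1) (torus_embedding A)
      = range (\<lambda>s p. inv (torus_embedding A) (rotation_z (2 * pi * s) *v torus_embedding A p))"
    by (auto simp: induced_action_def rotations_about_axis3)
  also have "\<dots> = range rotate"
    using assms by (simp add: torus_embedding_rotate inv_f_f[OF inj_torus_embedding])
  finally show ?thesis .
qed

lemma rotate_rotate [simp]: "rotate s (rotate t p) = rotate (s + t) p"
  by (cases p rule: torus2_cases) (simp add: algebra_simps)

lemma rotate_0 [simp]: "rotate 0 p = p"
  by (cases p rule: torus2_cases) simp

lemma revolution_torus_embedding:
  assumes "1 < A"
  shows "revolution_about 0 (axis 3 1) (range (torus_embedding A))"
  unfolding revolution_about_def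
proof (intro conjI ballI)
  show "axis 3 1 \<noteq> (0 :: real ^ 3)" by (simp add: axis_eq_0_iff)
  fix T assume "T \<in> rotations_about 0 (axis 3 1)"
  then obtain s where T: "T = (\<lambda>x. rotation_z (2 * pi * s) *v x)"
    by (auto simp: rotations_about_axis3)
  have "T ` range (torus_embedding A) = torus_embedding A ` range (rotate s)"
    using assms by (simp add: T image_image torus_embedding_rotate)
  also have "range (rotate s) = UNIV"
    by (metis add.right_inverse rotate_0 rotate_rotate surjI)
  finally show "T ` range (torus_embedding A) = range (torus_embedding A)" .
qed

lemma isometric_torus_embedding:
  assumes "1 < A"
  shows "isometric_embedding (torus_metric A) (torus_embedding A)"
proof -
  have "frechet_derivative (embedding_coords A) (at x) = embedding_coords_deriv A x" for x
    using embedding_coords_has_derivative by (metis frechet_derivative_at)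
  then show ?thesis
    using assms smooth_embedding_coords[of A] inj_torus_embedding[OF assms]
    by (simp add: isometric_embedding_def smooth_on_torus_def inner_embedding_coords_deriv)
qed

lemma radius_bounds: "A - 1 \<le> radius A t" "radius A t \<le> A + 1"
  using cos_ge_minus_one[of "2 * pi * t"] cos_le_one[of "2 * pi * t"]
  unfolding radius_def by linarith+

lemma riemannian_torus_metric:
  assumes "1 < A"
  shows "riemannian_metric (torus_metric A)"
  unfolding riemannian_metric_def
proof (intro conjI allI impI)
  show "smooth_on_torus (torus_metric A)" by (simp add: smooth_on_torus_def smooth_metric_coords)
  fix p
  obtain x where p: "p = abs_torus2 x" by (rule torus2_cases)
  show "transpose (torus_metric A p) = torus_metric A p" by (simp add: p transpose_def vec_2_eq_iff)
  fix v :: "real ^ 2" assume v: "v \<noteq> 0"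
  have "v \<bullet> (torus_metric A p *v v) = (v $ 1)\<^sup>2 + (radius A (x $ 1) * v $ 2)\<^sup>2"
    by (simp add: p inner_vec_def sum_2 matrix_vector_mult_def power2_eq_square algebra_simps)
  moreover have "radius A (x $ 1) \<noteq> 0" using radius_bounds(1)[of A "x $ 1"] assms by auto
  ultimately show "v \<bullet> (torus_metric A p *v v) > 0"
    using v by (simp add: vec_2_eq_iff sum_power2_gt_zero_iff)
qed

text \<open>A rotation lifts to a translation of the second coordinate. Its differential is the
  identity, and the metric depends only on the first coordinate.\<close>

lemma invariant_torus_metric: "invariant_metric (range rotate) (torus_metric A)"
  unfolding invariant_metric_def
proof
  fix \<phi> assume "\<phi> \<in> range rotate"
  then obtain s where \<phi>: "\<phi> = rotate s" by blast
  define \<Phi> :: "real ^ 2 \<Rightarrow> real ^ 2" where "\<Phi> = (\<lambda>x. x + s *\<^sub>R axis 2 1)"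
  have "(\<Phi> has_derivative (\<lambda>v. v)) (at x)" for x
    unfolding \<Phi>_def by (auto intro!: derivative_eq_intros)
  then have D: "frechet_derivative \<Phi> (at x) = (\<lambda>v. v)" for x
    by (metis frechet_derivative_at)
  show "\<exists>\<Phi> :: real ^ 2 \<Rightarrow> real ^ 2. smooth \<Phi> \<and>
        (\<forall>x. \<phi> (abs_torus2 x) = abs_torus2 (\<Phi> x)) \<and>
        (\<forall>x v w. frechet_derivative \<Phi> (at x) v \<bullet>
                   (torus_metric A (abs_torus2 (\<Phi> x)) *v frechet_derivative \<Phi> (at x) w)
                 = v \<bullet> (torus_metric A (abs_torus2 x) *v w))"
  proof (intro exI[of _ \<Phi>] conjI allI)
    show "smooth \<Phi>"
      unfolding smooth_def \<Phi>_def
      by (intro allI C_times_add C_times_const bounded_linear_imp_C_times bounded_linear_ident)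
  qed (simp_all add: \<phi> D, simp_all add: \<Phi>_def metric_coords_def axis_def)
qed

section \<open>Area and Laplacian of the torus metric\<close>

lemma sqrt_det_metric_coords:
  assumes "1 < A"
  shows "sqrt (det (metric_coords A x)) = radius A (x $ 1)"
  using assms radius_bounds(1)[of A "x $ 1"] by (simp add: det_2)

lemma Vol_torus_metric_ge:
  assumes "1 < A"
  shows "A - 1 \<le> Vol (torus_metric A)"
proof -
  have "integral (cbox 0 1 :: (real ^ 2) set) (\<lambda>x. A - 1) \<le> Vol (torus_metric A)"
    unfolding Vol_def torus_metric_abs sqrt_det_metric_coords[OF assms]
    using C_times_radius[of 0 A "1 :: 2"]
    by (intro integral_le integrable_continuous radius_bounds continuous_on_const)
       (auto intro: continuous_on_subset)
  moreover have "measure lborel (cbox 0 1 :: (real ^ 2) set) = 1"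
    by (subst content_cbox_cart) (simp_all add: interval_ne_empty_cart flip: cbox_interval)
  ultimately show ?thesis by simp
qed

text \<open>\<open>matrix_inv\<close> is a Hilbert choice; uniqueness of two-sided inverses pins it
  down.\<close>

lemma matrix_inv_eqI:
  fixes P Q :: "real ^ 'n ^ 'n"
  assumes "P ** Q = mat 1"
  shows "matrix_inv P = Q"
proof -
  have QP: "Q ** P = mat 1" using assms matrix_left_right_inverse by blast
  have "P ** matrix_inv P = mat 1 \<and> matrix_inv P ** P = mat 1"
    unfolding matrix_inv_def by (rule someI[of _ Q]) (use assms QP in simp)
  then have "matrix_inv P = matrix_inv P ** (P ** Q)" by (simp add: assms)
  also have "\<dots> = Q"
    using \<open>P ** matrix_inv P = mat 1 \<and> _\<close> by (simp add: matrix_mul_assoc)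
  finally show ?thesis .
qed

lemma matrix_inv_metric_coords:
  assumes "1 < A"
  shows "matrix_inv (metric_coords A x) = axis 1 (axis 1 1) + (1 / (radius A (x $ 1))\<^sup>2) *\<^sub>R axis 2 (axis 2 1)"
  using assms radius_bounds(1)[of A "x $ 1"]
  by (intro matrix_inv_eqI) (auto simp: vec_2_eq_iff matrix_matrix_mult_def sum_2 mat_def axis_def)

lemma partial_deriv_coordinate:
  fixes \<phi> :: "real \<Rightarrow> real"
  assumes "\<And>t. (\<phi> has_real_derivative \<psi> t) (at t)"
  shows "partial_deriv 1 (\<lambda>x. \<phi> (x $ 1)) x = \<psi> (x $ 1)" "partial_deriv 2 (\<lambda>x. \<phi> (x $ 1)) x = 0"
  unfolding partial_deriv_def
  using frechet_derivative_at[OF has_derivative_coordinate[OF assms, where x = x and i = 1], symmetric]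
  by (simp_all add: axis_def)

text \<open>For a function of the first coordinate only the (1,1) entry of the inverse metric, which
  is 1, contributes. With square root determinant r this leaves - (r u')' / r.\<close>

lemma laplace_beltrami_metric_coords:
  assumes "1 < A"
    and \<phi>: "\<And>t. (\<phi> has_real_derivative \<psi> t) (at t)"
    and \<psi>: "\<And>t. ((\<lambda>t. radius A t * \<psi> t) has_real_derivative D t) (at t)"
  shows "laplace_beltrami (metric_coords A) (\<lambda>x. \<phi> (x $ 1)) x = - D (x $ 1) / radius A (x $ 1)"
proof -
  have 2: "partial_deriv 2 (\<lambda>y. 0) x = 0"
    using partial_deriv_coordinate(2)[of "\<lambda>_. 0" "\<lambda>_. 0" x] by simp
  show ?thesis
    unfolding laplace_beltrami_def sqrt_det_metric_coords[OF assms(1)]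
    by (simp add: sum_2 matrix_inv_metric_coords[OF assms(1)] partial_deriv_coordinate[OF \<phi>]
      partial_deriv_coordinate(1)[OF \<psi>] 2) (simp add: axis_def partial_deriv_coordinate(1)[OF \<psi>] 2)
qed

section \<open>The first invariant eigenvalue\<close>

text \<open>The Green operator lives on the unit interval, but eigenfunctions must be smooth on the
  line. On each interval from n to n + 1 the extension is a translate of f; at an integer the
  one-sided derivatives f' 1 and f' 0 agree and glue.\<close>

lemma periodic_extension_deriv:
  fixes f f' :: "real \<Rightarrow> real"
  assumes d: "\<And>x. x \<in> {0..1} \<Longrightarrow> (f has_real_derivative f' x) (at x within {0..1})"
    and f: "f 1 = f 0" and f': "f' 1 = f' 0"
  shows "((\<lambda>x. f (frac x)) has_real_derivative f' (frac x)) (at x)"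
proof -
  have *: "((\<lambda>x. f (frac x)) has_real_derivative f' (y - of_int n)) (at y within {of_int n..of_int n + 1})"
    if y: "y \<in> {of_int n..of_int n + 1}" for y n
  proof -
    have "((\<lambda>x. f (x - of_int n)) has_real_derivative f' (y - of_int n) * 1)
        (at y within {of_int n..of_int n + 1})"
    proof (rule DERIV_image_chain[of f, unfolded o_def])
      have "(\<lambda>x. x - of_int n) ` {of_int n..of_int n + 1} = {0..1 :: real}"
        by (auto simp: image_iff intro: bexI[of _ "_ + of_int n"])
      then show "(f has_real_derivative f' (y - of_int n))
          (at (y - of_int n) within (\<lambda>x. x - of_int n) ` {of_int n..of_int n + 1})"
        using d[of "y - of_int n"] y by auto
    qed (auto intro!: derivative_eq_intros)
    moreover have "f (z - of_int n) = f (frac z)" if "z \<in> {of_int n..of_int n + 1}" for z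
    proof (cases "z = of_int n + 1")
      case True
      \<comment> \<open>At the right end \<open>frac\<close> jumps back to 0 and f 1 = f 0 repairs
        the value.\<close>
      then have "frac z = 0" by (metis Ints_1 Ints_add Ints_of_int frac_eq_0_iff)
      then show ?thesis using True f by simp
    next
      case False
      then have "frac z = z - of_int n"
        using that by (intro frac_unique_iff[THEN iffD2]) auto
      then show ?thesis by simp
    qed
    ultimately show ?thesis
      using y by (auto intro: has_field_derivative_transform_within[where d = 1])
  qed
  define n where "n = \<lfloor>x\<rfloor>"
  have x: "of_int n \<le> x" "x < of_int n + 1" by (auto simp: n_def)
  have frac: "frac x = x - of_int n" by (simp add: frac_def n_def)
  have right: "((\<lambda>x. f (frac x)) has_real_derivative f' (frac x)) (at x within {of_int n..of_int n + 1})"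
    unfolding frac by (rule *) (use x in auto)
  show ?thesis
  proof (cases "x = of_int n")
    case False
    then have "x \<in> interior {of_int n..of_int n + 1}" using x by simp
    then have "at x within {of_int n..of_int n + 1} = at x" by (rule at_within_interior)
    then show ?thesis using right by metis
  next
    case True
    \<comment> \<open>At the integer x = n, the left derivative comes from the preceding interval,
      where x corresponds to the endpoint 1.\<close>
    have "((\<lambda>x. f (frac x)) has_real_derivative f' (x - of_int (n - 1)))
        (at x within {of_int (n - 1)..of_int (n - 1) + 1})"
      by (rule *) (use True in auto)
    moreover have "f' (x - of_int (n - 1)) = f' (frac x)" using True f' by simp
    ultimately have left: "((\<lambda>x. f (frac x)) has_real_derivative f' (frac x))
        (at x within {of_int (n - 1)..of_int (n - 1) + 1})"
      by metis
    have "((\<lambda>x. f (frac x)) has_real_derivative f' (frac x))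
        (at x within {of_int (n - 1)..of_int (n - 1) + 1} \<union> {of_int n..of_int n + 1})"
      using left right unfolding has_field_derivative_iff by (rule Lim_Un)
    moreover have "{of_int (n - 1)..of_int (n - 1) + 1} \<union> {of_int n..of_int n + 1}
        = {of_int n - 1..of_int n + 1 :: real}"
      by auto
    moreover have "at x within {of_int n - 1..of_int n + 1} = at x"
      using True by (intro at_within_interior) simp
    ultimately show ?thesis by metis
  qed
qed

lemma frac_Ints_cong:
  assumes "s - t \<in> \<int>"
  shows "frac s = frac (t :: real)"
proof -
  have "s - frac t = (s - t) + of_int \<lfloor>t\<rfloor>" by (simp add: frac_def)
  also have "\<dots> \<in> \<int>" using assms by (intro Ints_add) auto
  finally show ?thesis by (simp add: frac_unique_iff frac_lt_1)
qed

text \<open>The derivative of 1 / r is smooth times 1 / r times 1 / r, so the induction hypothesis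
  applies to each factor.\<close>

lemma C_times_inverse_radius:
  assumes "1 < A"
  shows "C_times k (\<lambda>x :: real ^ 'n. 1 / radius A (x $ i))"
proof -
  have nz: "radius A t \<noteq> 0" for t using radius_bounds(1)[of A t] assms by auto
  have d: "((\<lambda>t. 1 / radius A t) has_real_derivative
      (2 * pi * sin (2 * pi * t)) * (1 / radius A t * (1 / radius A t))) (at t)" for t
    using nz[of t] by (auto intro!: derivative_eq_intros radius_deriv simp: divide_simps)
  show ?thesis
  proof (induction k)
    case 0
    show ?case by (rule C_times_0_coordinate[OF d])
  next
    case (Suc k)
    show ?case
      by (rule C_times_coordinate_SucI[OF d]) (intro C_times_mult C_times_const C_times_sin Suc)
  qed
qed

text \<open>Bootstrapping the first-order system: each of h and w has a derivative built from the
  other and smooth coefficients, so both gain one order together.\<close>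

lemma smooth_Sturm_Liouville_solution:
  assumes "1 < A"
    and h: "\<And>t. (h has_real_derivative w t / radius A t) (at t)"
    and w: "\<And>t. (w has_real_derivative c * (radius A t * h t)) (at t)"
  shows "smooth (\<lambda>x :: real ^ 'n. h (x $ i))"
proof -
  have "C_times k (\<lambda>x :: real ^ 'n. h (x $ i)) \<and> C_times k (\<lambda>x :: real ^ 'n. w (x $ i))" for k
  proof (induction k)
    case 0
    show ?case by (intro conjI C_times_0_coordinate[OF h] C_times_0_coordinate[OF w])
  next
    case (Suc k)
    have h': "(h has_real_derivative w t * (1 / radius A t)) (at t)" for t using h[of t] by simp
    show ?case
      by (intro conjI C_times_coordinate_SucI[OF h'] C_times_coordinate_SucI[OF w] C_times_mult
          C_times_const C_times_radius C_times_inverse_radius assms(1) Suc[THEN conjunct1] Suc[THEN conjunct2])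
  qed
  then show ?thesis by (simp add: smooth_def)
qed

section \<open>Invariant eigenfunctions as solutions of the one-dimensional problem\<close>

lemma invariant_function_rotate_iff:
  "invariant_function (range rotate) u \<longleftrightarrow> (\<forall>x s. u (abs_torus2 (x + s *\<^sub>R axis 2 1)) = u (abs_torus2 x))"
proof
  assume "invariant_function (range rotate) u"
  then have "u (rotate s (abs_torus2 x)) = u (abs_torus2 x)" for s x
    unfolding invariant_function_def by blast
  then show "\<forall>x s. u (abs_torus2 (x + s *\<^sub>R axis 2 1)) = u (abs_torus2 x)" by simp
next
  assume *: "\<forall>x s. u (abs_torus2 (x + s *\<^sub>R axis 2 1)) = u (abs_torus2 x)"
  have "u (rotate s p) = u p" for s p
    by (cases p rule: torus2_cases) (simp add: *)
  then show "invariant_function (range rotate) u" by (auto simp: invariant_function_def)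
qed

text \<open>w stands for r h', so the hypotheses are the eigenvalue equation as a first-order
  system. Periodicity under all integers is what lets h descend to the torus.\<close>

lemma invariant_eigenvalueI:
  assumes A: "1 < A"
    and h: "\<And>t. (h has_real_derivative w t / radius A t) (at t)"
    and w: "\<And>t. (w has_real_derivative - \<mu> * (radius A t * h t)) (at t)"
    and per: "\<And>s t. s - t \<in> \<int> \<Longrightarrow> h s = h t" and nz: "h t0 \<noteq> 0"
  shows "invariant_eigenvalue (range rotate) (torus_metric A) \<mu>"
proof -
  have r: "radius A t \<noteq> 0" for t using radius_bounds(1)[of A t] A by auto
  define u where "u = (\<lambda>p. h (rep_torus2 p $ 1))"
  have u: "u (abs_torus2 x) = h (x $ 1)" for x
    unfolding u_def using per
    by (intro descend[of "\<lambda>x. h (x $ 1)"]) (metis integer_periodic_def)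
  have "smooth_on_torus u"
    unfolding smooth_on_torus_def u by (rule smooth_Sturm_Liouville_solution[OF A h w])
  moreover have "invariant_function (range rotate) u"
    by (simp add: invariant_function_rotate_iff u axis_def)
  moreover have "u (abs_torus2 (t0 *\<^sub>R axis 1 1)) \<noteq> 0" using nz by (simp add: u)
  moreover have "laplace_beltrami (\<lambda>y. torus_metric A (abs_torus2 y)) (\<lambda>y. u (abs_torus2 y)) x
      = \<mu> * u (abs_torus2 x)" for x
    unfolding torus_metric_abs u
    using laplace_beltrami_metric_coords[OF A h, where D = "\<lambda>t. - \<mu> * (radius A t * h t)"] w r
    by simp
  ultimately show ?thesis unfolding invariant_eigenvalue_def by blast
qed

text \<open>An invariant function is determined by its restriction to the line \<open>e\<close>,
  which meets every orbit; this restriction is h, and w is r h'.\<close>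

lemma invariant_eigenvalueD:
  assumes A: "1 < A" and ev: "invariant_eigenvalue (range rotate) (torus_metric A) \<mu>"
  obtains h w where "\<And>t. (h has_real_derivative w t / radius A t) (at t)"
    "\<And>t. (w has_real_derivative - \<mu> * (radius A t * h t)) (at t)"
    "h 1 = h 0" "w 1 = w 0" "\<exists>t\<in>{0..1}. h t \<noteq> 0"
proof -
  have r: "radius A t \<noteq> 0" for t using radius_bounds(1)[of A t] A by auto
  obtain u p where u: "smooth_on_torus u" "invariant_function (range rotate) u" "u p \<noteq> 0"
    and lap: "\<And>x. laplace_beltrami (\<lambda>y. torus_metric A (abs_torus2 y)) (\<lambda>y. u (abs_torus2 y)) x
        = \<mu> * u (abs_torus2 x)"
    using ev unfolding invariant_eigenvalue_def by blast
  define U where "U = (\<lambda>x. u (abs_torus2 x))"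
  define V where "V = (\<lambda>x. frechet_derivative U (at x) (axis 1 1))"
  define e where "e = (\<lambda>t::real. t *\<^sub>R (axis 1 1 :: real ^ 2))"
  define h h' where "h = (\<lambda>t. U (e t))" and "h' = (\<lambda>t. V (e t))"
  \<comment> \<open>Two orders suffice: one to differentiate h, one to differentiate w.\<close>
  have C: "C_times (Suc (Suc 0)) U"
    using u(1) unfolding smooth_on_torus_def smooth_def U_def by blast
  have along: "((\<lambda>t. F (e t)) has_real_derivative frechet_derivative F (at (e t)) (axis 1 1)) (at t)"
    if "C_times (Suc 0) F" for F :: "real ^ 2 \<Rightarrow> real" and t
  proof -
    note F = C_times_SucD(1)[OF that, of "e t"]
    have "(e has_derivative (\<lambda>s. s *\<^sub>R axis 1 1)) (at t)"
      unfolding e_def by (auto intro!: derivative_eq_intros)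
    from has_derivative_compose[OF this F]
    have "((\<lambda>t. F (e t)) has_derivative (\<lambda>s. frechet_derivative F (at (e t)) (s *\<^sub>R axis 1 1))) (at t)" .
    then show ?thesis
      using has_derivative_linear[OF F] by (simp add: has_field_derivative_def linear_cmul mult.commute[of _ "frechet_derivative _ _ _"])
  qed
  have h_deriv: "(h has_real_derivative h' t) (at t)" for t
    unfolding h_def h'_def V_def by (rule along[OF C_times_Suc_imp[OF C]])
  have h'_deriv: "\<exists>d. (h' has_real_derivative d) (at t)" for t
    unfolding h'_def using along[of V t] C_times_SucD(2)[OF C, of "axis 1 1"] V_def by blast
  define w where "w = (\<lambda>t. radius A t * h' t)"
  \<comment> \<open>Only existence of the derivative is known here; the eigenvalue equation
    identifies d below.\<close>
  have "\<exists>d. (w has_real_derivative d) (at t)" for t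
    unfolding w_def using h'_deriv[of t] DERIV_mult[OF radius_deriv] by blast
  then obtain d where d: "\<And>t. (w has_real_derivative d t) (at t)" by metis
  have U: "U x = h (x $ 1)" for x
  proof -
    have "U x = u (abs_torus2 (x + (- x $ 2) *\<^sub>R axis 2 1))"
      using u(2)[unfolded invariant_function_rotate_iff, rule_format, of x "- x $ 2"]
      by (simp only: U_def)
    also have "x + (- x $ 2) *\<^sub>R axis 2 1 = e (x $ 1)"
      by (simp add: vec_2_eq_iff e_def axis_def)
    finally show ?thesis by (simp add: h_def U_def)
  qed
  have eq: "- d t / radius A t = \<mu> * h t" for t
  proof -
    have "laplace_beltrami (metric_coords A) (\<lambda>x. h (x $ 1)) (e t) = \<mu> * h t"
      using lap[of "e t"] unfolding torus_metric_abs U_def[symmetric, THEN fun_cong] U by (simp add: e_def)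
    then show ?thesis
      using laplace_beltrami_metric_coords[OF A h_deriv d[unfolded w_def], of "e t"] by (simp add: e_def)
  qed
  have "d t = - \<mu> * (radius A t * h t)" for t
  proof -
    have "d t = - ((- d t / radius A t) * radius A t)" using r[of t] by simp
    also have "\<dots> = - \<mu> * (radius A t * h t)" unfolding eq by simp
    finally show ?thesis .
  qed
  then have w_deriv: "(w has_real_derivative - \<mu> * (radius A t * h t)) (at t)" for t
    using d[of t] by simp
  have per: "h s = h t" if "s - t \<in> \<int>" for s t
  proof -
    have "abs_torus2 (e s) = abs_torus2 (e t)"
      using that Ints_minus[OF that] unfolding torus2.abs_eq_iff
      by (simp add: e_def forall_2 axis_def)
    then show ?thesis by (simp add: h_def U_def)
  qed
  \<comment> \<open>h and its translate by 1 are the same function, and derivatives are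
    unique.\<close>
  have "h' 1 = h' 0"
  proof -
    have "((\<lambda>t. h (t + 1)) has_real_derivative h' 1) (at 0)"
      using DERIV_shift[of h "h' 1" 0 1] h_deriv[of 1] by simp
    moreover have "(\<lambda>t. h (t + 1)) = h" by (auto intro!: per)
    ultimately show ?thesis using h_deriv[of 0] DERIV_unique by metis
  qed
  then have "w 1 = w 0" by (simp add: w_def radius_def)
  moreover obtain x where "p = abs_torus2 x" by (rule torus2_cases)
  then have "h (x $ 1) \<noteq> 0" using u(3) U by (simp add: U_def)
  then have "h (frac (x $ 1)) \<noteq> 0"
    using per[of "x $ 1" "frac (x $ 1)"] by (simp add: frac_def)
  then have "\<exists>t\<in>{0..1}. h t \<noteq> 0"
    using frac_ge_0 frac_lt_1 by (intro bexI[of _ "frac (x $ 1)"]) (auto intro: less_imp_le)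
  moreover have "(h has_real_derivative w t / radius A t) (at t)" for t
    using h_deriv[of t] r[of t] by (simp add: w_def)
  ultimately show ?thesis using that w_deriv per[of 1 0] by auto
qed

text \<open>The value 1 / M is identified exactly: the maximiser provides this eigenvalue, and the
  variational bound \<open>top\<close> excludes smaller nonzero ones. Only then is M
  estimated.\<close>

lemma lambda1_ge:
  assumes A: "1 < A"
  shows "(A - 1) / (A + 1) \<le> lambda1 (range rotate) (torus_metric A)"
proof -
  interpret weight "radius A" "A - 1" "A + 1"
  proof
    show "continuous_on {0..1} (radius A)"
      by (rule DERIV_continuous_on[OF has_field_derivative_at_within[OF radius_deriv]])
  qed (use A radius_bounds in auto)
  have r: "radius A t \<noteq> 0" for t using radius_bounds(1)[of A t] A by auto
  obtain M h where M: "0 < M" "M \<le> (A + 1) / (A - 1)" and h: "h \<in> mean_zero" "\<exists>x\<in>{0..1}. h x \<noteq> 0"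
    and green: "\<And>x. x \<in> {0..1} \<Longrightarrow> green h x = M * h x"
    and top: "\<And>f. f \<in> mean_zero \<Longrightarrow> energy f f \<le> M * ip f f"
    using green_top_eigenvalue by blast
  note ch = mean_zeroD(1)[OF h(1)]
  \<comment> \<open>From \<open>green h = M * h\<close> one gets r h' = \<open>flux h / M\<close>,
    whose derivative is - r h / M: the equation for the eigenvalue 1 / M on the unit interval, to be
    extended periodically.\<close>
  have ev: "invariant_eigenvalue (range rotate) (torus_metric A) (1 / M)"
  proof -
    have h_deriv: "(h has_real_derivative flux h x / M / radius A x) (at x within {0..1})"
      if x: "x \<in> {0..1}" for x
    proof -
      have "((\<lambda>x. green h x / M) has_real_derivative flux h x / radius A x / M) (at x within {0..1})"
        by (intro DERIV_cdivide green_deriv ch x)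
      then have "(h has_real_derivative flux h x / radius A x / M) (at x within {0..1})"
        by (rule has_field_derivative_transform_within[OF _ zero_less_one x]) (use M green in auto)
      then show ?thesis by (simp add: mult.commute)
    qed
    have w_deriv: "((\<lambda>x. flux h x / M) has_real_derivative - (1 / M) * (radius A x * h x)) (at x within {0..1})"
      if x: "x \<in> {0..1}" for x
      using DERIV_cdivide[OF flux_deriv[OF ch x], of M] by simp
    have hp: "h 1 = h 0" using green[of 0] green[of 1] green_ends[OF ch] M by simp
    have fp: "flux h 1 = flux h 0" by (rule flux_ends[OF h(1)])
    have rp: "radius A 1 = radius A 0" by (simp add: radius_def)
    have rf: "radius A (frac t) = radius A t" for t by (rule radius_periodic) (simp add: frac_def)
    obtain t0 where t0: "t0 \<in> {0..1}" "h t0 \<noteq> 0" using h(2) by blast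
    \<comment> \<open>t0 may be 1, where \<open>frac\<close> is 0; the equality h 1 = h 0 carries
      the nonzero value over.\<close>
    have "h (frac t0) \<noteq> 0"
    proof (cases "t0 = 1")
      case False
      then have "frac t0 = t0" using t0 by (simp add: frac_eq)
      then show ?thesis using t0 by simp
    qed (use t0 hp in simp)
    show ?thesis
    proof (rule invariant_eigenvalueI[OF A, where h = "\<lambda>t. h (frac t)" and w = "\<lambda>t. flux h (frac t) / M"])
      show "((\<lambda>t. h (frac t)) has_real_derivative flux h (frac t) / M / radius A t) (at t)" for t
        using periodic_extension_deriv[OF h_deriv hp, of t] by (simp add: fp rp rf)
      show "((\<lambda>t. flux h (frac t) / M) has_real_derivative - (1 / M) * (radius A t * h (frac t))) (at t)" for t
        using periodic_extension_deriv[OF w_deriv, of t] by (simp add: fp rp rf hp)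
      show "h (frac s) = h (frac t)" if "s - t \<in> \<int>" for s t
        using frac_Ints_cong[OF that] by simp
    qed fact
  qed
  have least: "1 / M \<le> \<mu>" if \<mu>: "\<mu> \<noteq> 0" "invariant_eigenvalue (range rotate) (torus_metric A) \<mu>" for \<mu>
  proof -
    obtain v w where v: "\<And>t. (v has_real_derivative w t / radius A t) (at t)"
      and w: "\<And>t. (w has_real_derivative - \<mu> * (radius A t * v t)) (at t)"
      and per: "v 1 = v 0" "w 1 = w 0" and nz: "\<exists>t\<in>{0..1}. v t \<noteq> 0"
      using invariant_eigenvalueD[OF A \<mu>(2)] by metis
    note v' = has_field_derivative_at_within[OF v] and w' = has_field_derivative_at_within[OF w]
    have cv: "continuous_on {0..1} v" by (rule DERIV_continuous_on[OF v'])
    \<comment> \<open>Integrating w' over one period gives 0, and \<mu> is nonzero, so v has mean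
      zero.\<close>
    have "integral {0..1} (\<lambda>t. - \<mu> * (radius A t * v t)) = 0"
      using integral_01_deriv[of w, OF w'] per by simp
    then have m: "integral {0..1} (\<lambda>t. radius A t * v t) = 0" using \<mu>(1) by simp
    then have vm: "v \<in> mean_zero" using cv by (simp add: mean_zero_def)
    have flux: "w t / \<mu> = flux v t" if "t \<in> {0..1}" for t
    proof (rule flux_unique[OF cv _ _ that])
      show "((\<lambda>t. w t / \<mu>) has_real_derivative - (radius A t * v t)) (at t within {0..1})" for t
        using DERIV_cdivide[OF w', of \<mu>] \<mu>(1) by simp
      have "integral {0..1} (\<lambda>t. w t / radius A t) = 0"
        using integral_01_deriv[of v, OF v'] per by simp
      then have "integral {0..1} (\<lambda>t. 1 / \<mu> * (w t / radius A t)) = 0"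
        by (simp only: integral_mult_right mult_zero_right)
      then show "integral {0..1} (\<lambda>t. w t / \<mu> / radius A t) = 0" by (simp add: mult.commute)
    qed
    have gr: "1 / \<mu> * v t = green v t" if "t \<in> {0..1}" for t
    proof (rule green_unique[OF cv _ _ that])
      show "((\<lambda>t. 1 / \<mu> * v t) has_real_derivative flux v t / radius A t) (at t within {0..1})"
        if "t \<in> {0..1}" for t
        using DERIV_cmult[OF v', of "1 / \<mu>"] by (simp flip: flux[OF that])
      show "integral {0..1} (\<lambda>t. radius A t * (1 / \<mu> * v t)) = 0"
        using mean_zeroD(2)[OF mean_zero_scale[OF vm, of "1 / \<mu>"]] .
    qed
    \<comment> \<open>v is an eigenfunction of the Green operator with eigenvalue 1 / \<mu>, so its
      Rayleigh quotient is 1 / \<mu>.\<close>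
    have "energy v v = ip (green v) v" by (rule ip_green[OF cv vm, symmetric])
    also have "\<dots> = ip (\<lambda>t. 1 / \<mu> * v t) v" by (intro ip_cong gr[symmetric] refl)
    also have "\<dots> = integral {0..1} (\<lambda>t. 1 / \<mu> * (radius A t * v t * v t))"
      unfolding ip_def by (intro arg_cong[where f = "integral {0..1}"] ext) (simp add: mult_ac)
    also have "\<dots> = 1 / \<mu> * ip v v" unfolding ip_def by (rule integral_mult_right)
    finally have e: "energy v v = 1 / \<mu> * ip v v" .
    have "ip v v \<noteq> 0" using ip_eq_0[OF cv] nz by blast
    then have pos: "0 < ip v v" using ip_nonneg[OF cv] by simp
    \<comment> \<open>The sign of \<mu> is needed to turn 1 / \<mu> \<le> M into 1 / M \<le>
      \<mu>.\<close>
    have "0 \<le> 1 / \<mu>" using energy_nonneg[OF cv] pos by (simp only: e zero_le_mult_iff) auto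
    then have "0 < \<mu>" using \<mu>(1) by simp
    moreover have "1 / \<mu> \<le> M" using top[OF vm] pos unfolding e by (rule mult_right_le_imp_le)
    ultimately show ?thesis using M(1) by (simp add: field_simps)
  qed
  have "lambda1 (range rotate) (torus_metric A) = 1 / M"
    unfolding lambda1_def using M ev least by (intro Least_equality) auto
  also have "(A - 1) / (A + 1) \<le> 1 / M"
    using M A by (simp add: field_simps)
  finally show ?thesis .
qed

theorem proposition5p1:
  shows "Sup {ereal (lambda1 G g * Vol g) | G g.
           \<exists>c n f. riemannian_metric g \<and> isometric_embedding g f \<and>
                   revolution_about c n (range f) \<and>
                   G = induced_action c n f \<and> invariant_metric G g} = \<infinity>"
    (is "Sup ?S = _")
proof (rule ereal_top)
  fix B :: real
  \<comment> \<open>A \<ge> 3 makes the eigenvalue at least 1 / 2, and A \<ge> 2 * B + 1 makes half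
    of the area bound A - 1 at least B.\<close>
  define A where "A = max 3 (2 * B + 1)"
  have A: "1 < A" "3 \<le> A" "2 * B + 1 \<le> A" by (auto simp: A_def)
  have "1 / 2 \<le> (A - 1) / (A + 1)" using A by (simp add: field_simps)
  also have "\<dots> \<le> lambda1 (range rotate) (torus_metric A)" by (rule lambda1_ge[OF A(1)])
  finally have "1 / 2 * (A - 1) \<le> lambda1 (range rotate) (torus_metric A) * Vol (torus_metric A)"
    using Vol_torus_metric_ge[OF A(1)] A by (intro mult_mono) auto
  then have "ereal B \<le> ereal (lambda1 (range rotate) (torus_metric A) * Vol (torus_metric A))"
    using A by simp
  also have "ereal (lambda1 (range rotate) (torus_metric A) * Vol (torus_metric A)) \<in> ?S"
    using riemannian_torus_metric[OF A(1)] isometric_torus_embedding[OF A(1)] revolution_torus_embedding[OF A(1)]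
      induced_action_torus_embedding[OF A(1)] invariant_torus_metric
    by (intro CollectI exI[of _ "range rotate"] exI[of _ "torus_metric A"] exI[of _ 0]
        exI[of _ "axis 3 1"] exI[of _ "torus_embedding A"] conjI refl) simp_all
  then have "ereal (lambda1 (range rotate) (torus_metric A) * Vol (torus_metric A)) \<le> Sup ?S"
    by (rule Sup_upper)
  finally show "ereal B \<le> Sup ?S" .
qed

end
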